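(* Provided a Delaunay triangulation $\Omega_h$, the fully discrete mixed scheme: given the time step size $\Delta t>0$ and $\rho_h^{n-1}\in Q_h$, find $\rho_h^n,\mu_h^n\in Q_h$ and $\mathbf{u}_h^n\in\mathbf{V}_h$ such that $$\mathcal{M}_h\left(\frac{\rho_h^n-\rho_h^{n-1}}{\Delta t},q_h\right)+\mathcal{A}_h\left(\hat\rho_h^{n-1};\mathbf{u}_h^n,q_h\right)=0\quad\text{for all } q_h\in Q_h,$$ $$\bar{\mathcal{M}}_h(\mathbf{u}_h^n,\mathbf{v}_h)-\bar{\mathcal{A}}_h(\mu_h^n,\mathbf{v}_h)=0\quad\text{for all } \mathbf{v}_h\in\mathbf{V}_h,$$ $$\mathcal{M}_h\left(\mu_h^n-\tfrac{m}{m-1}(\rho_h^n)^{m-1},r_h\right)=0\quad\text{for all } r_h\in Q_h,$$ with $\hat\rho_h^{n-1}$ the upwind flux and $\bar{\mathcal{M}}_h$ the mass-lumped velocity operator, is mass conservative and energy dissipative in the following forms: $$\mathcal{M}_h(\rho_h^n,1)=\mathcal{M}_h(\rho_h^{n-1},1),$$ $$\mathcal{M}_h(U(\rho_h^n),1)-\mathcal{M}_h(U(\rho_h^{n-1}),1)\le-\Delta t\sum_{E\in\mathcal{E}_h}\omega_E\,\hat\rho_h^{n-1}|_E\,\varphi_E(\mathbf{u}_h^n)^2,$$ where $U(\rho)=\frac{\rho^m}{m-1}$ is the physical energy and the right-hand side of the second relation comes from the mass-lumping quadrature formula for $\bar{\mathcal{M}}_h$.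
   Context: The scheme discretizes the porous medium equation $\partial_t\rho-\nabla\cdot\nabla(\rho^m)=0$ ($m>1$), with unknown density $\rho(t,x)\ge0$, in the first-order form $\rho_t+\nabla\cdot(\rho\mathbf{u})=0$, $\mathbf{u}+\nabla\mu=0$, $\mu=U'(\rho)=\frac{m}{m-1}\rho^{m-1}$, with $\mathbf{u}\cdot\mathbf{n}=0$ on $\partial\Omega$. Here $\Omega\subset\mathbb{R}^2$ is a bounded polygonal domain with outward unit normal $\mathbf{n}$, and $\Omega_h$ is a conforming triangulation of $\Omega$ into triangles. $\mathcal{E}_h$ is the set of edges of $\Omega_h$, $\mathcal{E}_K$ the set of edges of $K\in\Omega_h$, $\mathbf{n}_K$ the outward unit normal on $\partial K$, and $\mathbf{n}_E$ a fixed unit normal on the edge $E$. Spaces: $$Q_h=\{q_h\in L^2(\Omega): q_h|_K\in P_0(K)\ \text{for all } K\in\Omega_h\},$$ $$\mathbf{V}_h=\{\mathbf{v}_h\in H(\mathrm{div};\Omega): \mathbf{v}_h|_K\in RT_0(K)\ \text{for all } K\in\Omega_h,\ \mathbf{v}_h\cdot\mathbf{n}=0\text{ on }\partial\Omega\},$$ where $P_0(K)$ is the space of constants and $RT_0(K)=[P_0(K)]^2\oplus\mathbf{x}P_0(K)$ is the lowest-order Raviart–Thomas space. Operators: $$\mathcal{M}_h(\alpha,\beta)=\sum_{K\in\Omega_h}\int_K\alpha\beta\,dx,\quad \mathcal{A}_h(\gamma;\boldsymbol\alpha,\beta)=\sum_{K\in\Omega_h}\int_{\partial K}\gamma\,\boldsymbol\alpha\cdot\mathbf{n}_K\,\beta\,ds,\quad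 \bar{\mathcal{A}}_h(\alpha,\boldsymbol\beta)=\sum_{K\in\Omega_h}\int_{\partial K}\alpha\,\boldsymbol\beta\cdot\mathbf{n}_K\,ds,$$ evaluated with standard one-point integration rules; in the integrals over $\partial K$, the functions of $Q_h$ in the argument $\beta$ of $\mathcal{A}_h$ and the argument $\alpha$ of $\bar{\mathcal{A}}_h$ are evaluated from inside $K$. The velocity mass operator, approximating $\int_\Omega\boldsymbol\alpha\cdot\boldsymbol\beta\,dx$, is evaluated with the mass-lumping quadrature $$\bar{\mathcal{M}}_h(\boldsymbol\alpha,\boldsymbol\beta)=\sum_{K\in\Omega_h}\sum_{E\in\mathcal{E}_K}\omega_E^K\varphi_E(\boldsymbol\alpha)\varphi_E(\boldsymbol\beta)=\sum_{E\in\mathcal{E}_h}\omega_E\,\varphi_E(\boldsymbol\alpha)\,\varphi_E(\boldsymbol\beta),\qquad \omega_E=\sum_{K\supset E}\omega_E^K,\quad \omega_E^K=\tfrac12\cot\theta_E^K,$$ where $\theta_E^K$ is the angle opposite to $E$ in $K$ and $\varphi_E(\boldsymbol\alpha)=\boldsymbol\alpha\cdot\mathbf{n}_E$ denotes the normal flux of $\boldsymbol\alpha$ through $E$. Upwind flux: on an edge $E$ shared by two elements $K^+$ and $K^-$ with $\mathbf{u}_h^n\cdot\mathbf{n}_{K^-}|_E\ge0$, $\hat\rho_h^{n-1}|_E=(\rho_h^{n-1}|_{K^-})|_E$. On boundary edges $\mathbf{u}_h^n\cdot\mathbf{n}=0$, so the value of $\hat\rho_h^{n-1}$ there is immaterial.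 *)

theory Defs
  imports "HOL-Analysis.Analysis"
begin

section \<open>Polygonal domains and Delaunay triangulations\<close>

text \<open>The condition on \<open>interior (closure \<Omega>)\<close> excludes slits and punctures, where there would be no
  outward normal. The domain need be neither convex nor simply connected.\<close>

definition polygonal_domain :: "(real^2) set \<Rightarrow> bool" where
  "polygonal_domain \<Omega> \<longleftrightarrow>
     open \<Omega> \<and> connected \<Omega> \<and> \<Omega> \<noteq> {} \<and> bounded \<Omega> \<and> interior (closure \<Omega>) = \<Omega> \<and>
     (\<exists>S. finite S \<and> frontier \<Omega> = (\<Union>(a, b)\<in>S. closed_segment a b))"

text \<open>Elements are closed triangles. Conformity (two elements meet in a common face, possibly empty)
  is part of the library notion \<^const>\<open>triangulation\<close>.\<close>

definition triangulates :: "(real^2) set set \<Rightarrow> (real^2) set \<Rightarrow> bool" where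
  "triangulates T \<Omega> \<longleftrightarrow> triangulation T \<and> (\<forall>K\<in>T. 2 simplex K) \<and> \<Union>T = closure \<Omega>"

text \<open>Empty circumcircle property: no mesh vertex lies inside the open circumdisc of an element.\<close>

definition delaunay :: "(real^2) set set \<Rightarrow> bool" where
  "delaunay T \<longleftrightarrow>
     (\<forall>K\<in>T. \<forall>c r. (\<forall>v. v extreme_point_of K \<longrightarrow> dist c v = r) \<longrightarrow>
        (\<forall>K'\<in>T. \<forall>p. p extreme_point_of K' \<longrightarrow> r \<le> dist c p))"

definition element_edges :: "(real^2) set \<Rightarrow> (real^2) set set" where
  "element_edges K = {E. E edge_of K}"

definition mesh_edges :: "(real^2) set set \<Rightarrow> (real^2) set set" where
  "mesh_edges T = (\<Union>K\<in>T. element_edges K)"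

text \<open>The centroid of a triangle, or the midpoint of an edge.\<close>

definition barycenter :: "(real^2) set \<Rightarrow> real^2" where
  "barycenter S = (\<Sum>v | v extreme_point_of S. v) /\<^sub>R real (card {v. v extreme_point_of S})"

definition outward_normal :: "(real^2) set \<Rightarrow> (real^2) set \<Rightarrow> real^2" where
  "outward_normal K E = (THE n. norm n = 1 \<and> (\<forall>x\<in>E. \<forall>y\<in>K. (y - x) \<bullet> n \<le> 0))"

definition unit_edge_normals :: "(real^2) set set \<Rightarrow> ((real^2) set \<Rightarrow> real^2) \<Rightarrow> bool" where
  "unit_edge_normals T nE \<longleftrightarrow>
     (\<forall>E\<in>mesh_edges T. norm (nE E) = 1 \<and> (\<forall>x\<in>E. \<forall>y\<in>E. (y - x) \<bullet> nE E = 0))"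

definition opposite_angle :: "(real^2) set \<Rightarrow> (real^2) set \<Rightarrow> real" where
  "opposite_angle K E =
     (THE \<theta>. \<exists>a b p. K = convex hull {a, b, p} \<and> E = closed_segment a b \<and> p \<notin> E \<and>
        \<theta> = arccos (((a - p) \<bullet> (b - p)) / (norm (a - p) * norm (b - p))))"

section \<open>Function spaces\<close>

text \<open>Members of \<open>L\<^sup>2(\<Omega>)\<close> are represented by functions. The representatives of finite element
  functions are chosen to have the prescribed form everywhere in the interior of each element; their
  values on the edges, a null set, are arbitrary and never used. Values on \<open>\<partial>K\<close> are always
  one-sided limits from inside \<open>K\<close>.\<close>

definition L2 :: "(real^2) set \<Rightarrow> (real^2 \<Rightarrow> 'b::euclidean_space) set" where
  "L2 \<Omega> = {f. f \<in> borel_measurable (lebesgue_on \<Omega>) \<and>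
              integrable (lebesgue_on \<Omega>) (\<lambda>x. (norm (f x))\<^sup>2)}"

text \<open>Distributional divergence, tested against \<open>C\<^sup>1\<close> functions with compact support in \<open>\<Omega>\<close>.\<close>

definition has_weak_divergence ::
  "(real^2) set \<Rightarrow> (real^2 \<Rightarrow> real^2) \<Rightarrow> (real^2 \<Rightarrow> real) \<Rightarrow> bool" where
  "has_weak_divergence \<Omega> v g \<longleftrightarrow>
     (\<forall>\<phi> G. (\<forall>x. GDERIV \<phi> x :> G x) \<and> continuous_on UNIV G \<and>
        (\<exists>S. compact S \<and> S \<subseteq> \<Omega> \<and> (\<forall>x. x \<notin> S \<longrightarrow> \<phi> x = 0)) \<longrightarrow>
        (LINT x|lebesgue_on \<Omega>. v x \<bullet> G x) = - (LINT x|lebesgue_on \<Omega>. g x * \<phi> x))"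

definition H_div :: "(real^2) set \<Rightarrow> (real^2 \<Rightarrow> real^2) set" where
  "H_div \<Omega> = {v \<in> L2 \<Omega>. \<exists>g \<in> L2 \<Omega>. has_weak_divergence \<Omega> v g}"

definition trace_from :: "(real^2) set \<Rightarrow> (real^2 \<Rightarrow> 'b::t2_space) \<Rightarrow> real^2 \<Rightarrow> 'b" where
  "trace_from K f x = Lim (at x within interior K) f"

definition normal_trace ::
  "(real^2) set \<Rightarrow> (real^2) set \<Rightarrow> (real^2 \<Rightarrow> real^2) \<Rightarrow> real^2 \<Rightarrow> real" where
  "normal_trace K E v x = trace_from K v x \<bullet> outward_normal K E"

definition Q_h :: "(real^2) set \<Rightarrow> (real^2) set set \<Rightarrow> (real^2 \<Rightarrow> real) set" where
  "Q_h \<Omega> T = {q \<in> L2 \<Omega>. \<forall>K\<in>T. \<exists>c. \<forall>x\<in>interior K. q x = c}"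

definition V_h :: "(real^2) set \<Rightarrow> (real^2) set set \<Rightarrow> (real^2 \<Rightarrow> real^2) set" where
  "V_h \<Omega> T =
     {v \<in> H_div \<Omega>.
        (\<forall>K\<in>T. \<exists>a b. \<forall>x\<in>interior K. v x = a + b *\<^sub>R x) \<and>
        (\<forall>K\<in>T. \<forall>E\<in>element_edges K. E \<subseteq> frontier \<Omega> \<longrightarrow> (\<forall>x\<in>E. normal_trace K E v x = 0))}"

section \<open>Discrete operators\<close>

text \<open>Integrals over elements and edges are evaluated by the one-point rule at the barycenter, with
  weight \<open>measure lebesgue K\<close> (the area of \<open>K\<close>) and \<open>diameter E\<close> (the length of \<open>E\<close>), respectively.\<close>

definition M_h :: "(real^2) set set \<Rightarrow> (real^2 \<Rightarrow> real) \<Rightarrow> (real^2 \<Rightarrow> real) \<Rightarrow> real" where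
  "M_h T \<alpha> \<beta> = (\<Sum>K\<in>T. measure lebesgue K * (\<alpha> (barycenter K) * \<beta> (barycenter K)))"

text \<open>The first argument \<open>\<gamma>\<close> is single-valued on edges.\<close>

definition A_h :: "(real^2) set set \<Rightarrow> ((real^2) set \<Rightarrow> real) \<Rightarrow> (real^2 \<Rightarrow> real^2) \<Rightarrow>
    (real^2 \<Rightarrow> real) \<Rightarrow> real" where
  "A_h T \<gamma> \<alpha> \<beta> =
     (\<Sum>K\<in>T. \<Sum>E\<in>element_edges K.
        diameter E * (\<gamma> E * normal_trace K E \<alpha> (barycenter E) * trace_from K \<beta> (barycenter E)))"

definition Abar_h :: "(real^2) set set \<Rightarrow> (real^2 \<Rightarrow> real) \<Rightarrow> (real^2 \<Rightarrow> real^2) \<Rightarrow> real" where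
  "Abar_h T \<alpha> \<beta> =
     (\<Sum>K\<in>T. \<Sum>E\<in>element_edges K.
        diameter E * (trace_from K \<alpha> (barycenter E) * normal_trace K E \<beta> (barycenter E)))"

text \<open>\<open>\<phi>\<^sub>E(\<alpha>) = \<alpha> \<cdot> n\<^sub>E\<close>. For \<open>\<alpha>\<close> in \<open>V_h\<close> the normal component is constant along \<open>E\<close> and the same from
  all elements containing \<open>E\<close>; \<open>\<phi>\<^sub>E(\<alpha>)\<close> is this common value.\<close>

definition edge_flux :: "(real^2) set set \<Rightarrow> ((real^2) set \<Rightarrow> real^2) \<Rightarrow> (real^2) set \<Rightarrow>
    (real^2 \<Rightarrow> real^2) \<Rightarrow> real" where
  "edge_flux T nE E \<alpha> =
     (THE c. \<forall>K\<in>T. E \<in> element_edges K \<longrightarrow> (\<forall>x\<in>E. trace_from K \<alpha> x \<bullet> nE E = c))"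

definition local_weight :: "(real^2) set \<Rightarrow> (real^2) set \<Rightarrow> real" where
  "local_weight K E = cot (opposite_angle K E) / 2"

definition edge_weight :: "(real^2) set set \<Rightarrow> (real^2) set \<Rightarrow> real" where
  "edge_weight T E = (\<Sum>K | K \<in> T \<and> E \<in> element_edges K. local_weight K E)"

definition Mbar_h :: "(real^2) set set \<Rightarrow> ((real^2) set \<Rightarrow> real^2) \<Rightarrow>
    (real^2 \<Rightarrow> real^2) \<Rightarrow> (real^2 \<Rightarrow> real^2) \<Rightarrow> real" where
  "Mbar_h T nE \<alpha> \<beta> =
     (\<Sum>K\<in>T. \<Sum>E\<in>element_edges K. local_weight K E * edge_flux T nE E \<alpha> * edge_flux T nE E \<beta>)"

text \<open>A relation rather than a function: where \<open>u \<cdot> n = 0\<close> on \<open>E\<close> either neighbour may serve as the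
  upwind element, and on boundary edges the value is unconstrained.\<close>

definition upwind_flux :: "(real^2) set set \<Rightarrow> (real^2 \<Rightarrow> real^2) \<Rightarrow> (real^2 \<Rightarrow> real) \<Rightarrow>
    ((real^2) set \<Rightarrow> real) \<Rightarrow> bool" where
  "upwind_flux T u \<rho> \<rho>hat \<longleftrightarrow>
     (\<forall>K1\<in>T. \<forall>K2\<in>T. \<forall>E\<in>element_edges K1 \<inter> element_edges K2. K1 \<noteq> K2 \<longrightarrow>
        (\<exists>K\<in>{K1, K2}. \<forall>x\<in>E. normal_trace K E u x \<ge> 0 \<and> \<rho>hat E = trace_from K \<rho> x))"

definition energy_density :: "real \<Rightarrow> real \<Rightarrow> real" where
  "energy_density m r = r powr m / (m - 1)"

end

theory Submission
  imports Defs
begin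

text \<open>Testing the first equation with \<open>q = 1\<close> gives mass conservation, since interelement fluxes cancel.
  For the energy, convexity of \<open>U\<close> and the third equation bound the energy increment by
  \<open>M\<^sub>h(\<rho> - \<rho>\<^sub>0, \<mu>)\<close>. By the first equation with \<open>q = \<mu>\<close> this is \<open>-\<Delta>t A\<^sub>h(\<rho>hat; u, \<mu>)\<close>, which equals
  \<open>-\<Delta>t Abar\<^sub>h(\<mu>, v)\<close> for the field \<open>v\<close> of \<open>V\<^sub>h\<close> with edge fluxes \<open>\<rho>hat \<phi>\<^sub>E(u)\<close>; the second equation tested with
  this \<open>v\<close> turns it into the dissipation term.

  Both the cancellation of fluxes and the existence of \<open>v\<close> rest on the fact that a piecewise
  Raviart--Thomas field has a square integrable weak divergence iff its normal component is
  continuous across interior edges. This follows from the divergence theorem on a triangle, which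
  by affine invariance need only be proved for the fields \<open>x - p\<close>, \<open>p\<close> a vertex, on the reference triangle.\<close>

section \<open>Divergence theorem on the reference triangle\<close>

text \<open>Membership in \<open>H_div\<close> only says that some square integrable weak divergence
  exists, so a field of \<open>V_h\<close> carries no pointwise information across edges. A jump has
  to be excluded by showing that no integrable function reproduces its contribution, an integral
  along the edge. Even \<open>edge_flux\<close>, a definite description, is known to denote a value
  only after that. Conversely, \<open>v\<close> has to be constructed: on a triangle the three edge
  fluxes are exactly the degrees of freedom of a Raviart-Thomas field. The fields
  \<open>x - p\<close> serve both purposes, because they are tangential to the two edges through
  \<open>p\<close>: each yields a single edge term, and prescribing fluxes becomes a diagonal
  system. Mass lumping shapes the energy argument: \<open>Mbar_h\<close> sees a field only through
  its edge fluxes and is diagonal in them, so testing with \<open>v\<close> gives weighted squares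
  of the fluxes without cross terms. The one-point rules see only normal traces at edge barycenters,
  which makes \<open>A_h\<close> with \<rho>hat and \<open>Abar_h\<close> with \<open>v\<close>
  agree term by term.\<close>

lemma GDERIV_continuous:
  assumes "\<And>y. GDERIV \<phi> y :> G y"
  shows "continuous_on UNIV \<phi>"
  using assms has_derivative_continuous unfolding gderiv_def
  by (intro continuous_at_imp_continuous_on) blast

text \<open>\<open>lborel\<close> is determined by the volume of boxes, and the preimage of a box is
  a product of intervals. This carries Fubini from pairs of reals over to
  \<open>real^2\<close>.\<close>

lemma lborel_vec2:
  "(lborel :: (real^2) measure) = distr (lborel \<Otimes>\<^sub>M lborel) borel (\<lambda>(x, y). vector [x, y])"
proof (rule lborel_eqI)
  fix l u :: "real^2"
  assume lu: "\<And>b. b \<in> Basis \<Longrightarrow> l \<bullet> b \<le> u \<bullet> b"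
  have le: "l $ i \<le> u $ i" for i
    using lu[of "axis i 1"] by (auto simp: inner_axis Basis_vec_def)
  let ?J = "(\<lambda>(x, y). vector [x, y]) :: real \<times> real \<Rightarrow> real^2"
  have cont: "continuous_on UNIV ?J"
    unfolding case_prod_beta
    by (subst continuous_on_componentwise)
      (auto simp: Basis_vec_def inner_axis forall_2 intro!: continuous_intros)
  have J: "?J \<in> borel_measurable (lborel \<Otimes>\<^sub>M lborel)"
    using borel_measurable_continuous_onI[OF cont] by (simp add: lborel_prod)
  have vim: "?J -` box l u = box (l$1) (u$1) \<times> box (l$2) (u$2)"
    by (auto simp: mem_box_cart forall_2)
  have "emeasure (distr (lborel \<Otimes>\<^sub>M lborel) borel ?J) (box l u)
      = emeasure (lborel \<Otimes>\<^sub>M lborel) (?J -` box l u)"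
    using J by (simp add: emeasure_distr space_pair_measure)
  also have "\<dots> = ennreal (u$1 - l$1) * ennreal (u$2 - l$2)"
    unfolding vim using le by (simp add: lborel.emeasure_pair_measure_Times)
  also have "\<dots> = ennreal (\<Prod>i\<in>UNIV. (u - l) $ i)"
    using le by (simp add: UNIV_2 ennreal_mult)
  also have "(\<Prod>i\<in>UNIV. (u - l) $ i) = (\<Prod>b\<in>Basis. (u - l) \<bullet> b)"
  proof -
    have B: "(Basis :: (real^2) set) = (\<lambda>i. axis i 1) ` UNIV" by (auto simp: Basis_vec_def)
    show ?thesis unfolding B
      by (subst prod.reindex) (auto simp: inj_on_def axis_eq_axis inner_axis)
  qed
  finally show "emeasure (distr (lborel \<Otimes>\<^sub>M lborel) borel ?J) (box l u) = (\<Prod>b\<in>Basis. (u - l) \<bullet> b)" .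
qed simp

lemma absolutely_integrable_continuous_compact:
  fixes f :: "'a::euclidean_space \<Rightarrow> 'b::euclidean_space"
  assumes "compact S" "continuous_on S f"
  shows "f absolutely_integrable_on S"
  unfolding set_integrable_def
  using borel_integrable_compact[OF assms]
  by (subst integrable_completion) (auto)

lemma compact_borel_integral:
  fixes f :: "'a::euclidean_space \<Rightarrow> real"
  assumes "compact S" "continuous_on S f"
  shows "integral S f = (LINT x|lborel. indicator S x * f x)"
  using set_borel_integral_eq_integral(2)[of S f] borel_integrable_compact[OF assms]
  by (simp add: set_integrable_def set_lebesgue_integral_def)

definition ref_triangle :: "(real^2) set" where
  "ref_triangle = {y. 0 \<le> y$1 \<and> 0 \<le> y$2 \<and> y$1 + y$2 \<le> 1}"

lemma compact_ref_triangle: "compact ref_triangle"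
proof (rule compact_eq_bounded_closed[THEN iffD2, OF conjI])
  have "ref_triangle \<subseteq> cbox 0 1"
    by (auto simp: ref_triangle_def mem_box_cart forall_2)
  then show "bounded ref_triangle" by (rule bounded_subset[OF bounded_cbox])
  show "closed ref_triangle"
    unfolding ref_triangle_def
    by (intro closed_Collect_conj closed_Collect_le continuous_intros)
qed

text \<open>Both orders are provided because each partial derivative is to be integrated first along
  its own axis.\<close>

lemma ref_triangle_Fubini:
  fixes f :: "real^2 \<Rightarrow> real"
  assumes f: "continuous_on UNIV f"
  shows "integral ref_triangle f =
      (LINT t|lborel. LINT s|lborel. indicator ref_triangle (vector [s, t]) * f (vector [s, t]))"
    and "integral ref_triangle f =
      (LINT s|lborel. LINT t|lborel. indicator ref_triangle (vector [s, t]) * f (vector [s, t]))"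
proof -
  let ?h = "\<lambda>y. indicator ref_triangle y * f y"
  have cf: "continuous_on ref_triangle f" using f continuous_on_subset by blast
  have int: "integrable lborel ?h"
    using borel_integrable_compact[OF compact_ref_triangle cf] by simp
  have hm: "?h \<in> borel_measurable borel" using borel_measurable_integrable[OF int] by simp
  have cont: "continuous_on UNIV ((\<lambda>(x, y). vector [x, y]) :: real \<times> real \<Rightarrow> real^2)"
    unfolding case_prod_beta
    by (subst continuous_on_componentwise)
      (auto simp: Basis_vec_def inner_axis forall_2 intro!: continuous_intros)
  have J: "((\<lambda>(x, y). vector [x, y]) :: real \<times> real \<Rightarrow> real^2) \<in> borel_measurable (lborel \<Otimes>\<^sub>M lborel)"
    using borel_measurable_continuous_onI[OF cont] by (simp add: lborel_prod)
  have eq: "(\<lambda>p. ?h ((\<lambda>(x, y). vector [x, y]) p)) = (\<lambda>(x, y). ?h (vector [x, y]))"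
    by auto
  have int2: "integrable (lborel \<Otimes>\<^sub>M lborel) (\<lambda>(x, y). ?h (vector [x, y]))"
    using int[unfolded lborel_vec2] integrable_distr_eq[OF J hm] unfolding eq by simp
  have "integral ref_triangle f = (LINT x|lborel. ?h x)"
    by (rule compact_borel_integral[OF compact_ref_triangle cf])
  also have "\<dots> = (LINT p|(lborel \<Otimes>\<^sub>M lborel). ?h ((\<lambda>(x, y). vector [x, y]) p))"
    by (subst lborel_vec2, rule integral_distr[OF J hm])
  also have "\<dots> = (LINT p|(lborel \<Otimes>\<^sub>M lborel). (\<lambda>(x, y). ?h (vector [x, y])) p)"
    unfolding eq ..
  finally have I: "integral ref_triangle f = \<dots>" .
  show "integral ref_triangle f = (LINT t|lborel. LINT s|lborel. ?h (vector [s, t]))"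
    unfolding I using lborel_pair.integral_snd[OF int2] by simp
  show "integral ref_triangle f = (LINT s|lborel. LINT t|lborel. ?h (vector [s, t]))"
    unfolding I using lborel_pair.integral_fst[OF int2] by simp
qed

text \<open>The integrand is the divergence of \<open>\<psi> y *\<^sub>R y\<close>. The position
  field is tangential to the two legs, so only the hypotenuse contributes; there its normal
  component 1/sqrt 2 cancels the length sqrt 2, hence the right side has no factor.\<close>

lemma ref_triangle_divergence:
  fixes \<psi> :: "real^2 \<Rightarrow> real"
  assumes d: "\<And>y. GDERIV \<psi> y :> G y" and G: "continuous_on UNIV G"
  shows "integral ref_triangle (\<lambda>y. y \<bullet> G y + 2 * \<psi> y) = integral {0..1} (\<lambda>t. \<psi> (vector [1 - t, t]))"
proof -
  let ?v = "\<lambda>s t. vector [s, t] :: real^2"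
  note c\<psi> = GDERIV_continuous[OF d]
  have cv1: "continuous_on S (\<lambda>s. ?v (f s) (g s))"
    if "continuous_on S f" "continuous_on S g" for S :: "real set" and f g
    using that by (subst continuous_on_componentwise)
      (auto simp: Basis_vec_def inner_axis forall_2 intro!: continuous_intros)
  have vec: "?v s t = s *\<^sub>R axis 1 1 + t *\<^sub>R axis 2 1" for s t
    by (simp add: vec_eq_iff forall_2 axis_def)
  have dv1: "((\<lambda>s. ?v s t) has_derivative (\<lambda>h. h *\<^sub>R axis 1 1)) (at s)" for s t
    unfolding vec by (auto intro!: derivative_eq_intros)
  have dv2: "((\<lambda>t. ?v s t) has_derivative (\<lambda>h. h *\<^sub>R axis 2 1)) (at t)" for s t
    unfolding vec by (auto intro!: derivative_eq_intros)
  have dp1: "((\<lambda>s. \<psi> (?v s t)) has_real_derivative G (?v s t) $ 1) (at s)" for s t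
    using has_derivative_compose[OF dv1 d[unfolded gderiv_def], of t s]
    by (simp add: has_field_derivative_def inner_axis' mult_commute_abs)
  have dp2: "((\<lambda>t. \<psi> (?v s t)) has_real_derivative G (?v s t) $ 2) (at t)" for s t
    using has_derivative_compose[OF dv2 d[unfolded gderiv_def], of s t]
    by (simp add: has_field_derivative_def inner_axis' mult_commute_abs)
  have cG: "continuous_on UNIV (\<lambda>y. G y $ i)" for i using G by (intro continuous_intros)
  have c1: "continuous_on UNIV (\<lambda>y. \<psi> y + y $ 1 * G y $ 1)"
    and c2: "continuous_on UNIV (\<lambda>y. \<psi> y + y $ 2 * G y $ 2)"
    by (intro continuous_intros c\<psi> cG)+
  have sub: "continuous_on S (\<lambda>s. h (k s))" if "continuous_on UNIV h" "continuous_on S k"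
    for h :: "real^2 \<Rightarrow> real" and k and S :: "real set"
    using continuous_on_compose2[OF that] by simp
  \<comment> \<open>Fundamental theorem for \<open>s * \<psi> (?v s t)\<close>: the factor
    \<open>s\<close> kills the leg \<open>s = 0\<close>, and the upper limit \<open>1 - t\<close>
    lies on the hypotenuse.\<close>
  have I1: "(LINT s|lborel. indicator ref_triangle (?v s t) * (\<psi> (?v s t) + ?v s t $ 1 * G (?v s t) $ 1))
      = indicator {0..1} t * ((1 - t) * \<psi> (?v (1 - t) t))" for t
  proof (cases "t \<in> {0..1}")
    case True
    have "indicator ref_triangle (?v s t) = (indicator {0..1 - t} s :: real)" for s
      using True by (auto simp: indicator_def ref_triangle_def)
    moreover have "(LINT s|lborel. (\<psi> (?v s t) + ?v s t $ 1 * G (?v s t) $ 1) * indicator {0..1 - t} s)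
       = (1 - t) * \<psi> (?v (1 - t) t) - 0 * \<psi> (?v 0 t)"
    proof (rule integral_FTC_Icc_real)
      show "0 \<le> 1 - t" using True by simp
      show "((\<lambda>s. s * \<psi> (?v s t)) has_real_derivative \<psi> (?v s t) + ?v s t $ 1 * G (?v s t) $ 1) (at s)" for s
        using DERIV_mult[OF DERIV_ident dp1, of t s] by (simp add: algebra_simps)
      have "continuous_on UNIV (\<lambda>s. \<psi> (?v s t) + ?v s t $ 1 * G (?v s t) $ 1)"
        by (rule sub[OF c1 cv1]) (intro continuous_intros)+
      then show "isCont (\<lambda>s. \<psi> (?v s t) + ?v s t $ 1 * G (?v s t) $ 1) s" for s
        using continuous_on_eq_continuous_at by blast
    qed
    ultimately show ?thesis using True by (simp add: mult.commute)
  next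
    case False
    then have "indicator ref_triangle (?v s t) = (0 :: real)" for s
      by (auto simp: indicator_def ref_triangle_def)
    then show ?thesis using False by simp
  qed
  have I2: "(LINT t|lborel. indicator ref_triangle (?v s t) * (\<psi> (?v s t) + ?v s t $ 2 * G (?v s t) $ 2))
      = indicator {0..1} s * ((1 - s) * \<psi> (?v s (1 - s)))" for s
  proof (cases "s \<in> {0..1}")
    case True
    have "indicator ref_triangle (?v s t) = (indicator {0..1 - s} t :: real)" for t
      using True by (auto simp: indicator_def ref_triangle_def)
    moreover have "(LINT t|lborel. (\<psi> (?v s t) + ?v s t $ 2 * G (?v s t) $ 2) * indicator {0..1 - s} t)
       = (1 - s) * \<psi> (?v s (1 - s)) - 0 * \<psi> (?v s 0)"
    proof (rule integral_FTC_Icc_real)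
      show "0 \<le> 1 - s" using True by simp
      show "((\<lambda>t. t * \<psi> (?v s t)) has_real_derivative \<psi> (?v s t) + ?v s t $ 2 * G (?v s t) $ 2) (at t)" for t
        using DERIV_mult[OF DERIV_ident dp2, of s t] by (simp add: algebra_simps)
      have "continuous_on UNIV (\<lambda>t. \<psi> (?v s t) + ?v s t $ 2 * G (?v s t) $ 2)"
        by (rule sub[OF c2 cv1]) (intro continuous_intros)+
      then show "isCont (\<lambda>t. \<psi> (?v s t) + ?v s t $ 2 * G (?v s t) $ 2) t" for t
        using continuous_on_eq_continuous_at by blast
    qed
    ultimately show ?thesis using True by (simp add: mult.commute)
  next
    case False
    then have "indicator ref_triangle (?v s t) = (0 :: real)" for t
      by (auto simp: indicator_def ref_triangle_def)
    then show ?thesis using False by simp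
  qed
  have cc: "continuous_on {0..1} (\<lambda>t. (1 - t) * \<psi> (?v (1 - t) t))" 
     "continuous_on {0..1} (\<lambda>t. (1 - t) * \<psi> (?v t (1 - t)))" "continuous_on {0..1} (\<lambda>t. t * \<psi> (?v (1 - t) t))"
    by (intro continuous_intros sub[OF c\<psi>] cv1)+
  have E1: "integral ref_triangle (\<lambda>y. \<psi> y + y $ 1 * G y $ 1) = integral {0..1} (\<lambda>t. (1 - t) * \<psi> (?v (1 - t) t))"
    unfolding ref_triangle_Fubini(1)[OF c1] I1
    by (rule compact_borel_integral[symmetric, OF _ cc(1)]) simp
  have "integral ref_triangle (\<lambda>y. \<psi> y + y $ 2 * G y $ 2) = integral {0..1} (\<lambda>t. (1 - t) * \<psi> (?v t (1 - t)))"
    unfolding ref_triangle_Fubini(2)[OF c2] I2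
    by (rule compact_borel_integral[symmetric, OF _ cc(2)]) simp
  \<comment> \<open>Reflecting t to 1 - t puts both boundary integrals on the same parametrisation,
    where the weights \<open>1 - t\<close> and \<open>t\<close> add up to 1.\<close>
  also have "\<dots> = integral {0..1} (\<lambda>t. t * \<psi> (?v (1 - t) t))"
  proof -
    have "((\<lambda>t. (1 - t) * \<psi> (?v t (1 - t))) has_integral integral {0..1} (\<lambda>t. (1 - t) * \<psi> (?v t (1 - t)))) (cbox 0 1)"
      using integrable_integral[OF integrable_continuous_interval[OF cc(2)]] by simp
    from has_integral_affinity[OF this, of "-1" 1]
    show ?thesis by (simp add: integral_unique image_affinity_atLeastAtMost minus_mult_commute)
  qed
  finally have E2: "integral ref_triangle (\<lambda>y. \<psi> y + y $ 2 * G y $ 2) = \<dots>" .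
  have "integral ref_triangle (\<lambda>y. y \<bullet> G y + 2 * \<psi> y) =
     integral ref_triangle (\<lambda>y. (\<psi> y + y $ 1 * G y $ 1) + (\<psi> y + y $ 2 * G y $ 2))"
    by (simp add: inner_vec_def UNIV_2 algebra_simps)
  also have "\<dots> = integral ref_triangle (\<lambda>y. \<psi> y + y $ 1 * G y $ 1)
      + integral ref_triangle (\<lambda>y. \<psi> y + y $ 2 * G y $ 2)"
    by (intro Henstock_Kurzweil_Integration.integral_add set_lebesgue_integral_eq_integral(1)
        absolutely_integrable_continuous_compact compact_ref_triangle continuous_on_subset[OF c1]
        continuous_on_subset[OF c2]) auto
  also have "\<dots> = integral {0..1} (\<lambda>t. (1 - t) * \<psi> (?v (1 - t) t) + t * \<psi> (?v (1 - t) t))"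
    unfolding E1 E2
    by (intro Henstock_Kurzweil_Integration.integral_add[symmetric] integrable_continuous_interval cc)
  also have "\<dots> = integral {0..1} (\<lambda>t. \<psi> (?v (1 - t) t))"
    by (simp add: algebra_simps)
  finally show ?thesis .
qed

section \<open>Triangles\<close>

definition det2 :: "real^2 \<Rightarrow> real^2 \<Rightarrow> real" where
  "det2 v w = v$1 * w$2 - v$2 * w$1"

text \<open>Cramer's rule in the plane.\<close>

lemma det2_span:
  assumes "det2 v w \<noteq> 0"
  shows "z = (det2 z w / det2 v w) *\<^sub>R v + (det2 v z / det2 v w) *\<^sub>R w"
  using assms by (simp add: vec_eq_iff forall_2 field_simps) (simp add: det2_def algebra_simps)

lemma collinear_iff_det2: "collinear {a, b, c} \<longleftrightarrow> det2 (b - a) (c - a) = 0"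
proof -
  have "collinear {a, b, c} \<longleftrightarrow> collinear {0, b - a, c - a}"
    using collinear_3[of b a c] by (simp add: insert_commute)
  also have "\<dots> \<longleftrightarrow> det2 (b - a) (c - a) = 0"
  proof
    assume "collinear {0, b - a, c - a}"
    then consider "b - a = 0" | "c - a = 0" | k where "c - a = k *\<^sub>R (b - a)"
      unfolding collinear_lemma by blast
    then show "det2 (b - a) (c - a) = 0"
    proof cases
      case 3
      show ?thesis unfolding 3 by (simp add: det2_def)
    qed (simp_all add: det2_def)
  next
    assume d: "det2 (b - a) (c - a) = 0"
    define v w where "v = b - a" and "w = c - a"
    have d: "v$1 * w$2 = v$2 * w$1" using d by (simp add: det2_def v_def w_def)
    have "w = (w$1 / v$1) *\<^sub>R v" if "v$1 \<noteq> 0"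
      using d that by (simp add: vec_eq_iff forall_2 divide_simps mult_ac)
    moreover have "w = (w$2 / v$2) *\<^sub>R v" if "v$2 \<noteq> 0"
      using d that by (simp add: vec_eq_iff forall_2 divide_simps mult_ac)
    moreover have "v = 0" if "v$1 = 0" "v$2 = 0"
      using that by (simp add: vec_eq_iff forall_2)
    ultimately show "collinear {0, b - a, c - a}"
      unfolding collinear_lemma v_def[symmetric] w_def[symmetric] by metis
  qed
  finally show ?thesis .
qed

text \<open>Area of a parallelogram as base times height: \<open>w\<close> is the base,
  \<open>n\<close> its unit normal. In the proof, \<open>w\<close> is recognised as \<open>k\<close>
  times the quarter turn of \<open>n\<close>.\<close>

lemma det2_perp:
  assumes "norm n = 1" "n \<bullet> w = 0"
  shows "\<bar>det2 v w\<bar> = \<bar>v \<bullet> n\<bar> * norm w"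
proof -
  have n: "n$1 * n$1 + n$2 * n$2 = 1"
    using assms(1) by (simp add: norm_eq_1 inner_vec_def UNIV_2)
  have p: "n$1 * w$1 + n$2 * w$2 = 0"
    using assms(2) by (simp add: inner_vec_def UNIV_2)
  define k where "k = n$1 * w$2 - n$2 * w$1"
  have "k * n$1 = (n$1 * n$1 + n$2 * n$2) * w$2 - n$2 * (n$1 * w$1 + n$2 * w$2)"
    unfolding k_def by algebra
  then have w2: "w$2 = k * n$1" using n p by simp
  have "k * n$2 = n$1 * (n$1 * w$1 + n$2 * w$2) - (n$1 * n$1 + n$2 * n$2) * w$1"
    unfolding k_def by algebra
  then have w1: "w$1 = - k * n$2" using n p by simp
  have "det2 v w = k * (v \<bullet> n)"
    by (simp add: det2_def w1 w2 inner_vec_def UNIV_2 algebra_simps)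
  moreover have "norm w = \<bar>k\<bar>"
  proof -
    have "w \<bullet> w = k * k * (n$1 * n$1 + n$2 * n$2)"
      by (simp add: w1 w2 inner_vec_def UNIV_2 algebra_simps)
    then show ?thesis using n by (simp add: norm_eq_sqrt_inner)
  qed
  ultimately show ?thesis by (simp add: abs_mult)
qed

text \<open>The vectors orthogonal to a nonzero \<open>w\<close> form a line, which contains only
  two unit vectors. This is how normals seen from different elements are compared.\<close>

lemma unit_normal_unique:
  fixes n n' w :: "real^2"
  assumes "norm n = 1" "norm n' = 1" "n \<bullet> w = 0" "n' \<bullet> w = 0" "w \<noteq> 0"
  shows "n' = n \<or> n' = - n"
proof -
  have n: "n$1 * n$1 + n$2 * n$2 = 1" and n': "n'$1 * n'$1 + n'$2 * n'$2 = 1"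
    using assms(1,2) by (simp_all add: norm_eq_1 inner_vec_def UNIV_2)
  have "collinear {0, n', n}"
  proof -
    have "w$1 * (n'$1 * n$2 - n'$2 * n$1) = 0" "w$2 * (n'$1 * n$2 - n'$2 * n$1) = 0"
      using assms(3,4) unfolding inner_vec_def UNIV_2 by (simp; algebra)+
    moreover have "w$1 \<noteq> 0 \<or> w$2 \<noteq> 0" using assms(5) by (auto simp: vec_eq_iff forall_2)
    ultimately have "det2 (n' - 0) (n - 0) = 0" by (auto simp: det2_def)
    then show ?thesis using collinear_iff_det2 by blast
  qed
  moreover have "n \<noteq> 0" "n' \<noteq> 0" using assms(1,2) by auto
  ultimately obtain c where c: "n = c *\<^sub>R n'" unfolding collinear_lemma by blast
  then have "\<bar>c\<bar> = 1" using assms(1,2) by simp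
  then have "c = 1 \<or> c = - 1" by linarith
  with c show ?thesis by auto
qed

section \<open>Edges and outward normals of triangles\<close>

lemma triangle_simplexE:
  fixes K :: "(real^2) set"
  assumes "2 simplex K"
  obtains a b c where "\<not> collinear {a, b, c}" "K = convex hull {a, b, c}"
proof -
  obtain C where C: "\<not> affine_dependent C" "int (card C) = 3" "K = convex hull C"
    using assms unfolding simplex_def by auto
  then have "card C = 3" by simp
  then obtain a b c where abc: "C = {a, b, c}" "a \<noteq> b" "b \<noteq> c" "a \<noteq> c"
    by (auto simp: card_3_iff)
  with C(1) have "\<not> collinear {a, b, c}" by (simp add: collinear_3_eq_affine_dependent)
  with C(3) abc(1) that show ?thesis by blast
qed

lemma noncollinear_simps:
  assumes "\<not> collinear {a, b, c}"
  shows "a \<noteq> b" "b \<noteq> c" "a \<noteq> c" "\<not> affine_dependent {a, b, c}"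
    "\<not> collinear {b, c, a}" "\<not> collinear {c, a, b}" "\<not> collinear {b, a, c}"
  using assms by (auto simp: collinear_3_eq_affine_dependent insert_commute)

text \<open>Faces of the hull of affinely independent points are the hulls of subsets of these
  points; dimension one selects the two-point subsets.\<close>

lemma element_edges_triangle:
  assumes "\<not> collinear {a, b, c}"
  shows "element_edges (convex hull {a, b, c}) = {closed_segment a b, closed_segment b c, closed_segment c a}"
proof (intro set_eqI iffI)
  note nc = noncollinear_simps[OF assms]
  fix E
  assume "E \<in> element_edges (convex hull {a, b, c})"
  then obtain S where S: "S \<subseteq> {a, b, c}" "E = convex hull S" "aff_dim E = 1"
    unfolding element_edges_def edge_of_def
    using face_of_convex_hull_affine_independent[OF nc(4)] by auto
  have "\<not> affine_dependent S" using affine_independent_subset[OF nc(4) S(1)] .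
  then have "int (card S) - 1 = 1"
    using S(2,3) by (simp add: aff_dim_convex_hull aff_dim_affine_independent)
  then have "card S = 2" by simp
  then obtain x y where "S = {x, y}" "x \<noteq> y" by (auto simp: card_2_iff)
  then show "E \<in> {closed_segment a b, closed_segment b c, closed_segment c a}"
    using S(1,2) by (auto simp: segment_convex_hull insert_commute)
next
  note nc = noncollinear_simps[OF assms]
  fix E assume "E \<in> {closed_segment a b, closed_segment b c, closed_segment c a}"
  then obtain x y where xy: "E = closed_segment x y" "x \<noteq> y" "{x, y} \<subseteq> {a, b, c}"
    using nc(1-3) by blast
  have "E face_of convex hull {a, b, c}"
    using face_of_convex_hull_affine_independent[OF nc(4), of E] xy(1,3) segment_convex_hull by blast
  moreover have "aff_dim E = 1"
    using xy by (simp add: segment_convex_hull aff_dim_convex_hull aff_dim_2)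
  ultimately show "E \<in> element_edges (convex hull {a, b, c})"
    by (simp add: element_edges_def edge_of_def)
qed

lemma distinct_triangle_edges:
  fixes a b c :: "'a::euclidean_space"
  assumes "\<not> collinear {a, b, c}"
  shows "closed_segment a b \<noteq> closed_segment b c" "closed_segment b c \<noteq> closed_segment c a"
    "closed_segment c a \<noteq> closed_segment a b"
  using noncollinear_simps(1-3)[OF assms] by (auto simp: closed_segment_eq doubleton_eq_iff)

lemma triangle_edgeE:
  fixes K :: "(real^2) set"
  assumes "2 simplex K" "E \<in> element_edges K"
  obtains a b c where "\<not> collinear {a, b, c}" "K = convex hull {a, b, c}" "E = closed_segment a b"
proof -
  obtain a b c where abc: "\<not> collinear {a, b, c}" "K = convex hull {a, b, c}"
    using triangle_simplexE[OF assms(1)] .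
  have "E \<in> {closed_segment a b, closed_segment b c, closed_segment c a}"
    using assms(2) element_edges_triangle[OF abc(1)] abc(2) by simp
  then show ?thesis
    using that[of a b c] that[of b c a] that[of c a b] abc noncollinear_simps(5,6)[OF abc(1)]
    by (auto simp: insert_commute)
qed

lemma halfspace_convex_hull_le:
  fixes n :: "'a::real_inner"
  assumes "y \<in> convex hull S" "\<And>s. s \<in> S \<Longrightarrow> s \<bullet> n \<le> k"
  shows "y \<bullet> n \<le> k"
proof -
  have "convex {y. n \<bullet> y \<le> k}" by (rule convex_halfspace_le)
  then have "convex hull S \<subseteq> {y. n \<bullet> y \<le> k}"
    using assms(2) by (intro hull_minimal) (auto simp: inner_commute)
  with assms(1) show ?thesis by (auto simp: inner_commute)
qed

lemma outward_normal_triangle: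
  assumes "\<not> collinear {a, b, c}"
  defines "n \<equiv> outward_normal (convex hull {a, b, c}) (closed_segment a b)"
  shows "norm n = 1" "(b - a) \<bullet> n = 0" "(c - a) \<bullet> n < 0"
proof -
  let ?K = "convex hull {a, b, c}" and ?E = "closed_segment a b"
  note nc = noncollinear_simps[OF assms(1)]
  \<comment> \<open>The quarter turn of the edge vector. Its inner product with \<open>c - a\<close>
    is the orientation determinant, whose sign tells on which side of the edge \<open>c\<close>
    lies.\<close>
  define w :: "real^2" where "w = vector [- (b - a)$2, (b - a)$1]"
  have w0: "w \<noteq> 0" using nc(1) by (auto simp: w_def vec_eq_iff forall_2)
  have wn: "w \<bullet> (b - a) = 0" by (simp add: w_def inner_vec_def UNIV_2 algebra_simps)
  have wc: "(c - a) \<bullet> w = det2 (b - a) (c - a)"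
    by (simp add: w_def inner_vec_def UNIV_2 det2_def algebra_simps)
  define N where "N = (- sgn (det2 (b - a) (c - a)) / norm w) *\<^sub>R w"
  have D: "det2 (b - a) (c - a) \<noteq> 0" using assms(1) collinear_iff_det2 by blast
  have N1: "norm N = 1" using w0 D by (simp add: N_def abs_sgn_eq)
  have N2: "(b - a) \<bullet> N = 0" using wn by (simp add: N_def inner_commute)
  have N3: "(c - a) \<bullet> N < 0"
    using w0 D by (simp add: N_def wc mult.commute[of _ "det2 _ _"] abs_sgn[symmetric] divide_simps)
  let ?P = "\<lambda>n. norm n = 1 \<and> (\<forall>x\<in>?E. \<forall>y\<in>?K. (y - x) \<bullet> n \<le> 0)"
  have "outward_normal ?K ?E = N"
    unfolding outward_normal_def
  proof (rule the_equality)
    show "?P N"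
    proof (intro conjI ballI)
      fix x y assume x: "x \<in> ?E" and y: "y \<in> ?K"
      have "y \<bullet> N \<le> a \<bullet> N"
        using y N2 N3 by (intro halfspace_convex_hull_le[OF y]) (auto simp: inner_diff_left)
      moreover obtain u where "x = a + u *\<^sub>R (b - a)"
        using x by (auto simp: in_segment algebra_simps)
      then have "x \<bullet> N = a \<bullet> N" using N2 by (simp add: inner_add_left)
      ultimately show "(y - x) \<bullet> N \<le> 0" by (simp add: inner_diff_left)
    qed (rule N1)
  next
    fix M assume M: "?P M"
    have abc: "a \<in> ?K" "b \<in> ?K" "c \<in> ?K" by (auto intro: hull_inc)
    have "a \<in> ?E" "b \<in> ?E" by auto
    \<comment> \<open>Taking the endpoints of the edge in both roles turns the inequality into
      orthogonality; the sign that is left open is decided by \<open>c\<close>.\<close>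
    with abc M have "(b - a) \<bullet> M \<le> 0" "(a - b) \<bullet> M \<le> 0" and cM: "(c - a) \<bullet> M \<le> 0" by blast+
    then have "(b - a) \<bullet> M = 0" by (simp add: inner_diff_left)
    then have "M = N \<or> M = - N"
      using unit_normal_unique[of N M "b - a"] M N1 N2 nc(1) by (simp add: inner_commute)
    with cM N3 show "M = N" by auto
  qed
  then show "norm n = 1" "(b - a) \<bullet> n = 0" "(c - a) \<bullet> n < 0"
    using N1 N2 N3 by (simp_all add: n_def)
qed

section \<open>Divergence theorem for Raviart--Thomas fields\<close>

text \<open>The affine map \<open>g\<close> sends the origin to \<open>p\<close> and the reference
  triangle onto the given one, with the determinant as its Jacobian; under it the field
  \<open>x - p\<close> is the image of the position field.\<close>

lemma triangle_divergence_vertex: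
  fixes \<phi> :: "real^2 \<Rightarrow> real"
  assumes nc: "\<not> collinear {p, a, b}"
    and d: "\<And>y. GDERIV \<phi> y :> G y" and G: "continuous_on UNIV G"
  shows "integral (convex hull {p, a, b}) (\<lambda>x. (x - p) \<bullet> G x + 2 * \<phi> x)
    = \<bar>det2 (a - p) (b - p)\<bar> * integral {0..1} (\<lambda>t. \<phi> (a + t *\<^sub>R (b - a)))"
proof -
  define L where "L = (\<lambda>y::real^2. y$1 *\<^sub>R (a - p) + y$2 *\<^sub>R (b - p))"
  define g where "g = (\<lambda>y. p + L y)"
  have lin: "linear L"
    unfolding L_def by (rule linearI) (simp_all add: algebra_simps)
  have detL: "det (matrix L) = det2 (a - p) (b - p)"
    by (simp add: det_2 det2_def matrix_def L_def axis_def algebra_simps)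
  have D: "det2 (a - p) (b - p) \<noteq> 0" using nc collinear_iff_det2 by blast
  have "inj L" using det_nz_iff_inj[OF lin] D detL by simp
  then have inj: "inj_on g ref_triangle" by (auto simp: g_def inj_on_def)
  have img: "g ` ref_triangle = convex hull {p, a, b}"
  proof (intro set_eqI iffI)
    fix x assume "x \<in> g ` ref_triangle"
    then obtain y where y: "y \<in> ref_triangle" "x = g y" by blast
    have "x = (1 - y$1 - y$2) *\<^sub>R p + y$1 *\<^sub>R a + y$2 *\<^sub>R b"
      by (simp add: y(2) g_def L_def algebra_simps)
    then show "x \<in> convex hull {p, a, b}"
      using y(1) unfolding convex_hull_3 ref_triangle_def
      by (intro CollectI exI[of _ "1 - y$1 - y$2"] exI[of _ "y$1"] exI[of _ "y$2"]) auto
  next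
    fix x assume "x \<in> convex hull {p, a, b}"
    then obtain r s t where *: "0 \<le> r" "0 \<le> s" "0 \<le> t" "r + s + t = 1"
      "x = r *\<^sub>R p + s *\<^sub>R a + t *\<^sub>R b" unfolding convex_hull_3 by blast
    then have r: "r = 1 - s - t" by simp
    have "x = g (vector [s, t])" unfolding *(5) r by (simp add: g_def L_def algebra_simps)
    moreover have "vector [s, t] \<in> ref_triangle" using * by (simp add: ref_triangle_def)
    ultimately show "x \<in> g ` ref_triangle" by blast
  qed
  have dg: "(g has_derivative L) (at y within S)" for y S
    unfolding g_def using linear_imp_has_derivative[OF lin] has_derivative_add[OF has_derivative_const]
    by fastforce
  let ?F = "\<lambda>x. (x - p) \<bullet> G x + 2 * \<phi> x"
  note c\<phi> = GDERIV_continuous[OF d]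
  have cF: "continuous_on UNIV ?F" by (intro continuous_intros G c\<phi>)
  have cg: "continuous_on UNIV g"
    using dg has_derivative_continuous by (intro continuous_at_imp_continuous_on) blast
  \<comment> \<open>\<open>vec\<close> moves the scalar integrand to \<open>real^1\<close>, the form
    in which the change of variables rule applies.\<close>
  have blv: "bounded_linear (vec :: real \<Rightarrow> real^1)"
    by (rule linear_conv_bounded_linear[THEN iffD1], rule linearI) (simp_all add: vec_eq_iff)
  have aF: "(\<lambda>x. vec (?F x) :: real^1) absolutely_integrable_on g ` ref_triangle"
    by (intro absolutely_integrable_continuous_compact compact_continuous_image
        continuous_on_subset[OF cg] compact_ref_triangle bounded_linear.continuous_on[OF blv] continuous_on_subset[OF cF]) auto
  have cFg: "continuous_on ref_triangle (\<lambda>y. ?F (g y))"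
    using continuous_on_compose2[OF cF continuous_on_subset[OF cg]] by simp
  have iF: "?F integrable_on g ` ref_triangle"
    by (intro set_lebesgue_integral_eq_integral(1) absolutely_integrable_continuous_compact
        compact_continuous_image continuous_on_subset[OF cg] compact_ref_triangle
        continuous_on_subset[OF cF]) auto
  have iFg: "(\<lambda>y. ?F (g y)) integrable_on ref_triangle"
    by (intro set_lebesgue_integral_eq_integral(1) absolutely_integrable_continuous_compact
        compact_ref_triangle cFg)
  have "vec (integral (g ` ref_triangle) ?F) = (integral (g ` ref_triangle) (\<lambda>x. vec (?F x)) :: real^1)"
    by (rule integral_unique[symmetric, OF has_integral_linear[OF integrable_integral[OF iF] blv, unfolded o_def]])
  also have "\<dots> = integral ref_triangle (\<lambda>y. \<bar>det (matrix L)\<bar> *\<^sub>R vec (?F (g y)))"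
    by (rule has_absolute_integral_change_of_variables
      [OF sets_completionI_sets[OF borel_compact[OF compact_ref_triangle, folded sets_lborel]] dg inj,
       THEN iffD2, THEN conjunct2, symmetric, OF conjI[OF aF refl]])
  also have "\<dots> = \<bar>det (matrix L)\<bar> *\<^sub>R integral ref_triangle (\<lambda>y. vec (?F (g y)))"
    by simp
  also have "integral ref_triangle (\<lambda>y. vec (?F (g y)) :: real^1) = vec (integral ref_triangle (\<lambda>y. ?F (g y)))"
    by (rule integral_unique[OF has_integral_linear[OF integrable_integral[OF iFg] blv, unfolded o_def]])
  finally have "integral (g ` ref_triangle) ?F
      = \<bar>det2 (a - p) (b - p)\<bar> * integral ref_triangle (\<lambda>y. ?F (g y))"
    by (simp add: detL vec_eq_iff)
  \<comment> \<open>Since \<open>g y - p = L y\<close>, moving \<open>L\<close> to the other factor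
    of the inner product produces exactly the gradient of
    \<open>\<lambda>y. \<phi> (g y)\<close>.\<close>
  also have "(\<lambda>y. ?F (g y)) = (\<lambda>y. y \<bullet> vector [(a - p) \<bullet> G (g y), (b - p) \<bullet> G (g y)] + 2 * \<phi> (g y))"
    by (simp add: g_def L_def inner_vec_def[of _ "vector _"] UNIV_2 inner_add_left)
  also have "integral ref_triangle \<dots> = integral {0..1} (\<lambda>t. \<phi> (g (vector [1 - t, t])))"
  proof (rule ref_triangle_divergence)
    show "GDERIV (\<lambda>y. \<phi> (g y)) y :> vector [(a - p) \<bullet> G (g y), (b - p) \<bullet> G (g y)]" for y
      using has_derivative_compose[OF dg d[unfolded gderiv_def], of y UNIV]
      unfolding gderiv_def
      by (rule has_derivative_eq_rhs) (simp add: L_def inner_vec_def[of _ "vector _"] UNIV_2 inner_add_left)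
    have "continuous_on UNIV (\<lambda>y. v \<bullet> G (g y))" for v
      by (intro continuous_intros continuous_on_compose2[OF G cg]) auto
    then show "continuous_on UNIV (\<lambda>y. vector [(a - p) \<bullet> G (g y), (b - p) \<bullet> G (g y)] :: real^2)"
      by (subst continuous_on_componentwise)
        (auto simp: Basis_vec_def inner_axis forall_2)
  qed
  also have "(\<lambda>t. \<phi> (g (vector [1 - t, t]))) = (\<lambda>t. \<phi> (a + t *\<^sub>R (b - a)))"
    by (simp add: g_def L_def algebra_simps)
  finally show ?thesis unfolding img .
qed

section \<open>One-sided traces and normal components on edges\<close>

lemma barycenter_interior_triangle:
  fixes K :: "(real^2) set"
  assumes "2 simplex K"
  shows "barycenter K \<in> interior K"
proof -
  obtain a b c where abc: "\<not> collinear {a, b, c}" "K = convex hull {a, b, c}"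
    using triangle_simplexE[OF assms] .
  note nc = noncollinear_simps[OF abc(1)]
  have "{v. v extreme_point_of K} = {a, b, c}"
    using extreme_point_of_convex_hull_affine_independent[OF nc(4)] abc(2) by auto
  then have "barycenter K = (1/3) *\<^sub>R a + (1/3) *\<^sub>R b + (1/3) *\<^sub>R c"
    using nc(1-3) by (simp add: barycenter_def scaleR_add_right)
  moreover have "\<dots> \<in> interior (convex hull {a, b, c})"
  proof -
    have "DIM(real^2) = 2" by simp
    from interior_convex_hull_3_minimal[OF abc(1) this] show ?thesis
      by (auto intro!: exI[of _ "1/3"])
  qed
  ultimately show ?thesis by (simp add: abc(2))
qed

lemma triangle_props:
  fixes K :: "(real^2) set"
  assumes "2 simplex K"
  shows "compact K" "convex K" "closed K" "closure (interior K) = K" "bounded K"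
proof -
  have nonempty: "interior K \<noteq> {}" using barycenter_interior_triangle[OF assms] by blast
  show "compact K" "convex K" using assms by (simp_all add: compact_simplex convex_simplex)
  then show "closed K" "bounded K" by (simp_all add: compact_imp_closed compact_imp_bounded)
  show "closure (interior K) = K"
    using convex_closure_interior[OF \<open>convex K\<close> nonempty] \<open>closed K\<close> by simp
qed

lemma barycenter_segment: "barycenter (closed_segment a b) \<in> closed_segment a b"
proof (cases "a = b")
  case True
  then show ?thesis by (simp add: barycenter_def extreme_point_of_segment)
next
  case False
  have "{v. v extreme_point_of closed_segment a b} = {a, b}"
    by (auto simp: extreme_point_of_segment)
  with False have "barycenter (closed_segment a b) = midpoint a b"
    by (simp add: barycenter_def midpoint_def numeral_2_eq_2)
  then show ?thesis by simp
qed

text \<open>\<open>Lim\<close> can be evaluated only along a nontrivial filter, that is, if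
  \<open>x\<close> is a limit point of the interior. A triangle is the closure of its interior, so
  this holds for edge points too.\<close>

lemma trace_from_eq:
  fixes K :: "(real^2) set" and f :: "real^2 \<Rightarrow> 'b::t2_space"
  assumes K: "2 simplex K" and x: "x \<in> K" and g: "continuous_on UNIV g"
    and fg: "\<And>y. y \<in> interior K \<Longrightarrow> f y = g y"
  shows "trace_from K f x = g x"
proof -
  have "x \<in> closure (interior K)" using triangle_props(4)[OF K] x by simp
  then have "x islimpt interior K"
    by (auto simp: closure_def intro: interior_limit_point open_interior interiorI)
  then have nt: "at x within interior K \<noteq> bot" by (simp add: trivial_limit_within)
  have "(g \<longlongrightarrow> g x) (at x within interior K)"
    using g by (meson UNIV_I continuous_on continuous_on_subset subset_UNIV tendsto_within_subset)
  then have "(f \<longlongrightarrow> g x) (at x within interior K)"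
    by (rule Lim_transform_eventually) (auto simp: eventually_at_filter fg)
  then show ?thesis unfolding trace_from_def using tendsto_Lim[OF nt] by blast
qed

lemma element_edge_props:
  assumes "2 simplex K" "E \<in> element_edges K"
  shows "barycenter E \<in> E" "E \<subseteq> K" "compact E" "convex E" "E face_of K"
proof -
  obtain a b c where abc: "\<not> collinear {a, b, c}" "K = convex hull {a, b, c}" "E = closed_segment a b"
    using triangle_edgeE[OF assms] .
  show "barycenter E \<in> E" "compact E" "convex E" by (simp_all add: abc barycenter_segment)
  show "E face_of K" using assms(2) by (simp add: element_edges_def edge_of_def)
  then show "E \<subseteq> K" by (rule face_of_imp_subset)
qed

lemma outward_normal_edge:
  assumes "2 simplex K" "E \<in> element_edges K"
  shows "norm (outward_normal K E) = 1"
    and "\<And>x y. x \<in> E \<Longrightarrow> y \<in> E \<Longrightarrow> (y - x) \<bullet> outward_normal K E = 0"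
    and "\<And>x y. x \<in> E \<Longrightarrow> y \<in> K \<Longrightarrow> (y - x) \<bullet> outward_normal K E \<le> 0"
proof -
  obtain a b c where abc: "\<not> collinear {a, b, c}" "K = convex hull {a, b, c}" "E = closed_segment a b"
    using triangle_edgeE[OF assms] .
  note n = outward_normal_triangle[OF abc(1), folded abc(2,3)]
  show "norm (outward_normal K E) = 1" by (rule n(1))
  have E: "x \<bullet> outward_normal K E = a \<bullet> outward_normal K E" if x: "x \<in> E" for x
  proof -
    obtain u where "x = a + u *\<^sub>R (b - a)" using x abc(3) by (auto simp: in_segment algebra_simps)
    then show ?thesis using n(2) by (simp add: inner_add_left)
  qed
  then show "(y - x) \<bullet> outward_normal K E = 0" if "x \<in> E" "y \<in> E" for x y
    using that by (simp add: inner_diff_left)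
  show "(y - x) \<bullet> outward_normal K E \<le> 0" if x: "x \<in> E" and y: "y \<in> K" for x y
  proof -
    have "y \<bullet> outward_normal K E \<le> a \<bullet> outward_normal K E"
      using y n(2,3) unfolding abc(2)
      by (rule_tac halfspace_convex_hull_le) (auto simp: inner_diff_left abc(2))
    with E[OF x] show ?thesis by (simp add: inner_diff_left)
  qed
qed

text \<open>Along an edge the inner product of the position with the normal is constant. Hence the
  value at the barycenter stands for the whole edge.\<close>

lemma RT0_normal_component:
  assumes "2 simplex K" "E \<in> element_edges K" "x \<in> E" "y \<in> E"
  shows "(a + b *\<^sub>R x) \<bullet> outward_normal K E = (a + b *\<^sub>R y) \<bullet> outward_normal K E"
proof -
  have "(y - x) \<bullet> outward_normal K E = 0" using outward_normal_edge(2) assms by blast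
  then show ?thesis by (simp add: inner_add_left inner_diff_left)
qed

text \<open>The line integral over the edge divided by its length. An edge is a bare set whose
  endpoints are known only up to order, hence the definite description.\<close>

definition edge_mean :: "(real^2 \<Rightarrow> real) \<Rightarrow> (real^2) set \<Rightarrow> real" where
  "edge_mean \<phi> E =
     (THE I. \<exists>a b. E = closed_segment a b \<and> I = integral {0..1} (\<lambda>t. \<phi> (a + t *\<^sub>R (b - a))))"

lemma edge_mean_segment:
  assumes "continuous_on UNIV \<phi>"
  shows "edge_mean \<phi> (closed_segment a b) = integral {0..1} (\<lambda>t. \<phi> (a + t *\<^sub>R (b - a)))"
proof -
  \<comment> \<open>The substitution of 1 - t for t makes the value independent of the order of the
    endpoints.\<close>
  have swap: "integral {0..1} (\<lambda>t. \<phi> (b + t *\<^sub>R (a - b))) = integral {0..1} (\<lambda>t. \<phi> (a + t *\<^sub>R (b - a)))"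
  proof -
    have "continuous_on {0..1} (\<lambda>t. \<phi> (a + t *\<^sub>R (b - a)))"
      by (rule continuous_on_compose2[OF assms]) (auto intro!: continuous_intros)
    then have "((\<lambda>t. \<phi> (a + t *\<^sub>R (b - a))) has_integral
        integral {0..1} (\<lambda>t. \<phi> (a + t *\<^sub>R (b - a)))) (cbox 0 1)"
      using integrable_integral[OF integrable_continuous_interval] by simp
    from has_integral_affinity[OF this, of "-1" 1]
    have "((\<lambda>t. \<phi> (a + (1 - t) *\<^sub>R (b - a))) has_integral
        integral {0..1} (\<lambda>t. \<phi> (a + t *\<^sub>R (b - a)))) {0..1}"
      by (simp add: image_affinity_atLeastAtMost)
    moreover have "a + (1 - t) *\<^sub>R (b - a) = b + t *\<^sub>R (a - b)" for t
      by (simp add: algebra_simps)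
    ultimately show ?thesis by (simp add: integral_unique)
  qed
  show ?thesis
    unfolding edge_mean_def
  proof (rule the_equality)
    fix I
    assume "\<exists>a' b'. closed_segment a b = closed_segment a' b' \<and>
      I = integral {0..1} (\<lambda>t. \<phi> (a' + t *\<^sub>R (b' - a')))"
    then show "I = integral {0..1} (\<lambda>t. \<phi> (a + t *\<^sub>R (b - a)))"
      using swap by (auto simp: doubleton_eq_iff)
  qed blast
qed

lemma diameter_segment: "diameter (closed_segment a b) = dist a b" for a b :: "'a::euclidean_space"
proof (rule antisym)
  show "diameter (closed_segment a b) \<le> dist a b"
  proof (rule diameter_le)
    fix x y assume "x \<in> closed_segment a b" "y \<in> closed_segment a b"
    then obtain u v where xy: "x = a + u *\<^sub>R (b - a)" "y = a + v *\<^sub>R (b - a)"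
      and uv: "0 \<le> u" "u \<le> 1" "0 \<le> v" "v \<le> 1" by (auto simp: in_segment algebra_simps)
    have "x - y = (u - v) *\<^sub>R (b - a)" unfolding xy by (simp add: algebra_simps)
    then have "norm (x - y) = \<bar>u - v\<bar> * norm (b - a)" by simp
    also have "\<dots> \<le> 1 * norm (b - a)" using uv by (intro mult_right_mono) auto
    finally show "norm (x - y) \<le> dist a b" by (simp add: dist_norm norm_minus_commute)
  qed simp
  show "dist a b \<le> diameter (closed_segment a b)"
    by (rule diameter_bounded_bound) (auto simp: compact_imp_bounded)
qed

text \<open>The determinant is the edge length times the height of \<open>p\<close> above the edge,
  and this height is the normal component of \<open>x - p\<close> at any point \<open>x\<close> of
  the edge.\<close>

lemma triangle_divergence_vertex_edge:
  fixes \<phi> :: "real^2 \<Rightarrow> real"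
  assumes nc: "\<not> collinear {p, a, b}" and K: "K = convex hull {p, a, b}" and E: "E = closed_segment a b"
    and d: "\<And>y. GDERIV \<phi> y :> G y" and G: "continuous_on UNIV G" and x: "x \<in> E"
  shows "integral K (\<lambda>x. (x - p) \<bullet> G x + 2 * \<phi> x)
    = diameter E * ((x - p) \<bullet> outward_normal K E) * edge_mean \<phi> E"
proof -
  have nc': "\<not> collinear {a, b, p}" and K': "K = convex hull {a, b, p}"
    using nc K by (simp_all add: insert_commute)
  note n = outward_normal_triangle[OF nc', folded K' E]
  have "(a - p) \<bullet> outward_normal K E > 0" using n(3) by (simp add: inner_diff_left)
  moreover obtain u where "x = a + u *\<^sub>R (b - a)"
    using x E by (auto simp: in_segment algebra_simps)
  then have "(x - p) \<bullet> outward_normal K E = (a - p) \<bullet> outward_normal K E"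
    using n(2) by (simp add: inner_add_left inner_diff_left)
  moreover have "\<bar>det2 (a - p) (b - p)\<bar> = \<bar>det2 (a - p) (b - a)\<bar>"
    by (simp add: det2_def algebra_simps)
  moreover have "\<dots> = \<bar>(a - p) \<bullet> outward_normal K E\<bar> * norm (b - a)"
    using n by (intro det2_perp) (simp_all add: inner_commute)
  ultimately have "\<bar>det2 (a - p) (b - p)\<bar> = diameter E * ((x - p) \<bullet> outward_normal K E)"
    by (simp add: E diameter_segment dist_norm norm_minus_commute)
  then show ?thesis
    unfolding K triangle_divergence_vertex[OF nc d G]
    by (simp add: K E edge_mean_segment[OF GDERIV_continuous[OF d]])
qed

text \<open>The three vertex fields form a basis of the three-dimensional Raviart-Thomas space.
  Matching slopes fixes the sum of the coefficients; evaluation at one vertex leaves a 2 by 2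
  system.\<close>

lemma RT0_vertex_fields:
  fixes a b c \<alpha> :: "real^2"
  assumes "\<not> collinear {a, b, c}"
  obtains ca cb cc where
    "\<And>x. \<alpha> + \<beta> *\<^sub>R x = ca *\<^sub>R (x - a) + cb *\<^sub>R (x - b) + cc *\<^sub>R (x - c)" "ca + cb + cc = \<beta>"
proof -
  \<comment> \<open>\<open>z\<close> is minus the value of the field at \<open>c\<close>, where the
    third vertex field vanishes.\<close>
  define v w z where "v = a - c" and "w = b - c" and "z = - (\<alpha> + \<beta> *\<^sub>R c)"
  have D: "det2 v w \<noteq> 0"
    using noncollinear_simps(6)[OF assms] collinear_iff_det2 unfolding v_def w_def by blast
  define ca cb where "ca = det2 z w / det2 v w" and "cb = det2 v z / det2 v w"
  have "ca *\<^sub>R v + cb *\<^sub>R w = z"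
    unfolding ca_def cb_def by (rule det2_span[OF D, symmetric])
  then have "\<alpha> = - ca *\<^sub>R (a - c) - cb *\<^sub>R (b - c) - \<beta> *\<^sub>R c"
    by (simp add: v_def w_def z_def algebra_simps)
  then have "\<alpha> + \<beta> *\<^sub>R x = ca *\<^sub>R (x - a) + cb *\<^sub>R (x - b) + (\<beta> - ca - cb) *\<^sub>R (x - c)" for x
    by (simp add: algebra_simps)
  then show ?thesis using that by force
qed

text \<open>\<open>2 * \<beta>\<close> is the divergence of the field. By linearity the claim splits
  into vertex fields, each of which contributes only on the opposite edge.\<close>

lemma triangle_divergence_RT0:
  fixes \<phi> :: "real^2 \<Rightarrow> real"
  assumes K: "2 simplex K"
    and d: "\<And>y. GDERIV \<phi> y :> G y" and G: "continuous_on UNIV G"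
  shows "integral K (\<lambda>x. (\<alpha> + \<beta> *\<^sub>R x) \<bullet> G x + 2 * \<beta> * \<phi> x)
    = (\<Sum>E\<in>element_edges K. diameter E * ((\<alpha> + \<beta> *\<^sub>R barycenter E) \<bullet> outward_normal K E) * edge_mean \<phi> E)"
proof -
  obtain a b c where nc: "\<not> collinear {a, b, c}" and Kabc: "K = convex hull {a, b, c}"
    using triangle_simplexE[OF K] .
  note nc' = noncollinear_simps[OF nc]
  have K1: "K = convex hull {b, c, a}" and K2: "K = convex hull {c, a, b}"
    using Kabc by (simp_all add: insert_commute)
  obtain ca cb cc where split: "\<And>x. \<alpha> + \<beta> *\<^sub>R x = ca *\<^sub>R (x - a) + cb *\<^sub>R (x - b) + cc *\<^sub>R (x - c)"
    and \<beta>: "ca + cb + cc = \<beta>" using RT0_vertex_fields[OF nc, of \<alpha> \<beta>] by metis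
  define T where "T p = integral K (\<lambda>x. (x - p) \<bullet> G x + 2 * \<phi> x)" for p
  note c\<phi> = GDERIV_continuous[OF d]
  have int: "(\<lambda>x. (x - p) \<bullet> G x + 2 * \<phi> x) integrable_on K" for p
    by (intro set_lebesgue_integral_eq_integral(1) absolutely_integrable_continuous_compact
        triangle_props(1)[OF K] continuous_intros continuous_on_subset[OF G] continuous_on_subset[OF c\<phi>]) auto
  have eq: "(\<lambda>x. (\<alpha> + \<beta> *\<^sub>R x) \<bullet> G x + 2 * \<beta> * \<phi> x) =
     (\<lambda>x. ca * ((x - a) \<bullet> G x + 2 * \<phi> x) + cb * ((x - b) \<bullet> G x + 2 * \<phi> x) + cc * ((x - c) \<bullet> G x + 2 * \<phi> x))"
  proof
    fix x
    have "(\<alpha> + \<beta> *\<^sub>R x) \<bullet> G x = ca * ((x - a) \<bullet> G x) + cb * ((x - b) \<bullet> G x) + cc * ((x - c) \<bullet> G x)"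
      unfolding split by (simp add: inner_add_left)
    moreover have "2 * \<beta> * \<phi> x = ca * (2 * \<phi> x) + cb * (2 * \<phi> x) + cc * (2 * \<phi> x)"
      unfolding \<beta>[symmetric] by (simp add: algebra_simps)
    ultimately show "(\<alpha> + \<beta> *\<^sub>R x) \<bullet> G x + 2 * \<beta> * \<phi> x =
      ca * ((x - a) \<bullet> G x + 2 * \<phi> x) + cb * ((x - b) \<bullet> G x + 2 * \<phi> x) + cc * ((x - c) \<bullet> G x + 2 * \<phi> x)"
      by (simp only: distrib_left)
  qed
  have "((\<lambda>x. (\<alpha> + \<beta> *\<^sub>R x) \<bullet> G x + 2 * \<beta> * \<phi> x) has_integral (ca * T a + cb * T b + cc * T c)) K"
    unfolding eq T_def
    by (intro has_integral_add has_integral_mult_right integrable_integral int)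
  then have I: "integral K (\<lambda>x. (\<alpha> + \<beta> *\<^sub>R x) \<bullet> G x + 2 * \<beta> * \<phi> x) = ca * T a + cb * T b + cc * T c"
    by (rule integral_unique)
  let ?t = "\<lambda>E. diameter E * ((\<alpha> + \<beta> *\<^sub>R barycenter E) \<bullet> outward_normal K E) * edge_mean \<phi> E"
  \<comment> \<open>On the edge from \<open>q\<close> to \<open>r\<close> the fields based at
    \<open>q\<close> and \<open>r\<close> are tangential, so only the coefficient of the opposite
    vertex \<open>p\<close> survives. It is stated for arbitrary labels so that it covers the three
    cyclic relabellings.\<close>
  have edge: "?t (closed_segment q r) = cp * T p"
    if "\<not> collinear {p, q, r}" "K = convex hull {p, q, r}"
      "\<And>x. \<alpha> + \<beta> *\<^sub>R x = cp *\<^sub>R (x - p) + cq *\<^sub>R (x - q) + cr *\<^sub>R (x - r)" for p q r cp cq cr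
  proof -
    let ?E = "closed_segment q r"
    have E: "?E \<in> element_edges K"
      using element_edges_triangle[OF that(1)] that(2) by simp
    have "(barycenter ?E - q) \<bullet> outward_normal K ?E = 0" "(barycenter ?E - r) \<bullet> outward_normal K ?E = 0"
      using outward_normal_edge(2)[OF K E] barycenter_segment by auto
    then have "(\<alpha> + \<beta> *\<^sub>R barycenter ?E) \<bullet> outward_normal K ?E = cp * ((barycenter ?E - p) \<bullet> outward_normal K ?E)"
      unfolding that(3) by (simp add: inner_add_left)
    moreover have "T p = diameter ?E * ((barycenter ?E - p) \<bullet> outward_normal K ?E) * edge_mean \<phi> ?E"
      unfolding T_def
      by (rule triangle_divergence_vertex_edge[OF that(1,2) refl d G barycenter_segment])
    ultimately show ?thesis by simp
  qed
  have "(\<Sum>E\<in>element_edges K. ?t E)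
      = ?t (closed_segment a b) + ?t (closed_segment b c) + ?t (closed_segment c a)"
    unfolding Kabc element_edges_triangle[OF nc] using distinct_triangle_edges[OF nc] by simp
  also have "?t (closed_segment a b) = cc * T c"
    by (rule edge[OF nc'(6) K2, of cc ca cb]) (simp add: split)
  also have "?t (closed_segment b c) = ca * T a"
    by (rule edge[OF nc Kabc, of ca cb cc]) (simp add: split)
  also have "?t (closed_segment c a) = cb * T b"
    by (rule edge[OF nc'(5) K1, of cb cc ca]) (simp add: split)
  finally show ?thesis unfolding I by simp
qed

section \<open>Topology of the mesh\<close>

text \<open>In barycentric coordinates an inner point of the edge has two positive entries and the
  third is zero. An inward direction makes the third grow (\<open>q > 0\<close>), and the other two
  stay positive for small \<open>s\<close>.\<close>

lemma eventually_interior_triangle: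
  assumes K: "2 simplex K" "E \<in> element_edges K" and x: "x \<in> rel_interior E"
    and d: "d \<bullet> outward_normal K E < 0"
  shows "\<forall>\<^sub>F s in at_right 0. x + s *\<^sub>R d \<in> interior K"
proof -
  obtain a b c where abc: "\<not> collinear {a, b, c}" "K = convex hull {a, b, c}" "E = closed_segment a b"
    using triangle_edgeE[OF K] .
  note n = outward_normal_triangle[OF abc(1), folded abc(2,3)]
  note nc = noncollinear_simps[OF abc(1)]
  have "x \<in> open_segment a b" using x nc(1) by (simp add: abc(3) rel_interior_closed_segment)
  then obtain u where u: "x = (1 - u) *\<^sub>R a + u *\<^sub>R b" "0 < u" "u < 1"
    by (auto simp: in_segment)
  have "det2 (b - a) (c - a) \<noteq> 0" using abc(1) collinear_iff_det2 by blast
  from det2_span[OF this, of d] obtain p q where dpq: "d = p *\<^sub>R (b - a) + q *\<^sub>R (c - a)" by blast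
  have "d \<bullet> outward_normal K E = q * ((c - a) \<bullet> outward_normal K E)"
    using n(2) by (simp add: dpq inner_add_left)
  then have q: "q > 0" using d n(3) by (simp add: mult_less_0_iff)
  have l1: "((\<lambda>s. 1 - u - s * p - s * q) \<longlongrightarrow> 1 - u - 0 * p - 0 * q) (at_right 0)"
    and l2: "((\<lambda>s. u + s * p) \<longlongrightarrow> u + 0 * p) (at_right 0)"
    by (intro tendsto_intros)+
  have "\<forall>\<^sub>F s in at_right 0. 0 < 1 - u - s * p - s * q" "\<forall>\<^sub>F s in at_right 0. 0 < u + s * p"
    using u order_tendstoD(1)[OF l1, of 0] order_tendstoD(1)[OF l2, of 0] by simp_all
  moreover have "\<forall>\<^sub>F s in at_right (0::real). 0 < s" by (simp add: eventually_at_right_less)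
  ultimately show ?thesis
  proof eventually_elim
    case (elim s)
    have D2: "DIM(real^2) = 2" by simp
    have "x + s *\<^sub>R d = (1 - u - s * p - s * q) *\<^sub>R a + (u + s * p) *\<^sub>R b + (s * q) *\<^sub>R c"
      unfolding u(1) dpq by (simp add: algebra_simps)
    moreover have "0 < s * q" using elim q by simp
    moreover have "1 - u - s * p - s * q + (u + s * p) + s * q = 1" by simp
    ultimately show ?case
      unfolding abc(2) interior_convex_hull_3_minimal[OF abc(1) D2] using elim(1,2)
      by (intro CollectI exI[of _ "1 - u - s * p - s * q"] exI[of _ "u + s * p"] exI[of _ "s * q"]) simp
  qed
qed

lemma outward_normal_cases:
  assumes "2 simplex K" "E \<in> element_edges K" "norm n = 1" "\<forall>x\<in>E. \<forall>y\<in>E. (y - x) \<bullet> n = 0"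
  shows "outward_normal K E = n \<or> outward_normal K E = - n"
proof -
  obtain a b c where abc: "\<not> collinear {a, b, c}" "K = convex hull {a, b, c}" "E = closed_segment a b"
    using triangle_edgeE[OF assms(1,2)] .
  have "(b - a) \<bullet> n = 0" using assms(4) abc(3) by auto
  then show ?thesis
    using outward_normal_triangle[OF abc(1), folded abc(2,3)] assms(3) noncollinear_simps(1)[OF abc(1)]
    by (intro unit_normal_unique[of _ _ "b - a"]) (auto simp: inner_commute)
qed

locale triangulated_domain =
  fixes \<Omega> :: "(real^2) set" and T :: "(real^2) set set"
  assumes domain: "polygonal_domain \<Omega>" and mesh: "triangulates T \<Omega>"
begin

lemma finite_mesh: "finite T"
  and element_simplex: "K \<in> T \<Longrightarrow> 2 simplex K"
  and conforming: "K \<in> T \<Longrightarrow> K' \<in> T \<Longrightarrow> (K \<inter> K') face_of K"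
  and Union_mesh: "\<Union>T = closure \<Omega>"
  using mesh by (auto simp: triangulates_def triangulation_def)

lemma open_domain: "open \<Omega>" and bounded_domain: "bounded \<Omega>"
  and interior_closure_domain: "interior (closure \<Omega>) = \<Omega>"
  using domain by (auto simp: polygonal_domain_def)

lemma interior_element_subset: "K \<in> T \<Longrightarrow> interior K \<subseteq> \<Omega>"
  using interior_mono[of K "closure \<Omega>"] Union_mesh interior_closure_domain by blast

text \<open>By conformity the common part of two elements is a face of each, and a face that meets
  the interior of an element is the whole element.\<close>

lemma element_eq_if_interior:
  assumes "K \<in> T" "K' \<in> T" "x \<in> interior K" "x \<in> K'"
  shows "K = K'"
proof -
  have sub: "K1 \<subseteq> K2" if "K1 \<in> T" "K2 \<in> T" "x \<in> interior K1" "x \<in> K2" for K1 K2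
  proof -
    have "x \<in> (K1 \<inter> K2) \<inter> rel_interior K1"
      using that interior_subset interior_subset_rel_interior by blast
    then have "K1 \<subseteq> K1 \<inter> K2"
      using subset_of_face_of[OF conforming[OF that(1,2)] subset_refl] by blast
    then show ?thesis by blast
  qed
  have "K \<subseteq> K'" using sub assms by blast
  moreover have "x \<in> interior K'" using \<open>K \<subseteq> K'\<close> assms(3) interior_mono by blast
  then have "K' \<subseteq> K" using sub[of K' K] assms interior_subset by blast
  ultimately show ?thesis by blast
qed

text \<open>The common face of the two elements meets the relative interior of \<open>E\<close>,
  hence contains \<open>E\<close>; then \<open>E\<close> is a face of that face and so of
  \<open>K'\<close>. This rules out hanging nodes.\<close>

lemma edge_of_touching_element:
  assumes "K \<in> T" "E \<in> element_edges K" "x \<in> rel_interior E" "K' \<in> T" "x \<in> K'"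
  shows "E \<in> element_edges K'"
proof -
  note e = element_edge_props[OF element_simplex[OF assms(1)] assms(2)]
  have "x \<in> (K \<inter> K') \<inter> rel_interior E" using assms e(2) rel_interior_subset by blast
  then have sub: "E \<subseteq> K \<inter> K'"
    using subset_of_face_of[OF conforming[OF assms(1,4)] e(2)] by blast
  then have "E face_of (K \<inter> K')" using face_of_subset[OF e(5)] by blast
  then have "E face_of K'"
    using conforming[OF assms(4,1)] by (metis Int_commute face_of_trans)
  then show ?thesis using assms(2) by (simp add: element_edges_def edge_of_def)
qed

text \<open>\<open>E\<close> turns out to be a face of \<open>E'\<close> of the same dimension. The
  lemma serves to find a ball around an inner point of an edge that meets no other edge.\<close>

lemma edge_eq_if_meets_rel_interior:
  assumes "K \<in> T" "E \<in> element_edges K" "x \<in> rel_interior E"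
    and "K' \<in> T" "E' \<in> element_edges K'" "x \<in> E'"
  shows "E' = E"
proof -
  note e = element_edge_props[OF element_simplex[OF assms(4)] assms(5)]
  have E: "E \<in> element_edges K'"
    using edge_of_touching_element[OF assms(1-4)] e(2) assms(6) by blast
  note e2 = element_edge_props[OF element_simplex[OF assms(4)] E]
  have "E \<subseteq> E'"
    using subset_of_face_of[OF e(5) e2(2)] assms(3,6) by blast
  then have "E face_of E'" using face_of_subset[OF e2(5) _ e(2)] by blast
  moreover have "aff_dim E = aff_dim E'"
    using E assms(5) by (simp add: element_edges_def edge_of_def)
  ultimately show ?thesis using face_of_aff_dim_lt[OF e(4)] by force
qed

lemma rel_interior_edge_nonempty:
  assumes "K \<in> T" "E \<in> element_edges K"
  obtains x where "x \<in> rel_interior E"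
  using element_edge_props[OF element_simplex[OF assms(1)] assms(2)] rel_interior_eq_empty[of E] by blast

text \<open>From an inner point of the edge, a short step against the common normal lands in the
  interior of both elements.\<close>

lemma element_eq_if_same_side:
  assumes K: "K \<in> T" "E \<in> element_edges K" and K': "K' \<in> T" "E \<in> element_edges K'"
    and n: "outward_normal K E = outward_normal K' E"
  shows "K = K'"
proof -
  obtain x where x: "x \<in> rel_interior E" using rel_interior_edge_nonempty[OF K] .
  define d where "d = - outward_normal K E"
  have 1: "d \<bullet> outward_normal K E < 0"
    using outward_normal_edge(1)[OF element_simplex[OF K(1)] K(2)]
    by (auto simp: d_def norm_eq_1)
  have "\<forall>\<^sub>F s in at_right 0. x + s *\<^sub>R d \<in> interior K"
    by (rule eventually_interior_triangle[OF element_simplex[OF K(1)] K(2) x 1])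
  moreover have "\<forall>\<^sub>F s in at_right 0. x + s *\<^sub>R d \<in> interior K'"
    by (rule eventually_interior_triangle[OF element_simplex[OF K'(1)] K'(2) x 1[unfolded n]])
  ultimately have "\<forall>\<^sub>F s in at_right (0::real). K = K'"
    by eventually_elim (metis K(1) K'(1) element_eq_if_interior interior_subset subsetD)
  then show ?thesis by simp
qed

text \<open>A short step out of \<open>K\<close> along the normal stays in the open domain, hence
  lands in some element. The elements that avoid \<open>x\<close> form a closed set and are out of
  reach, so the element found contains \<open>x\<close> and therefore has \<open>E\<close> as an
  edge.\<close>

lemma opposite_element:
  assumes K: "K \<in> T" "E \<in> element_edges K" and x: "x \<in> rel_interior E" "x \<in> \<Omega>"
  obtains K' where "K' \<in> T" "E \<in> element_edges K'" "outward_normal K' E = - outward_normal K E"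
proof -
  let ?n = "outward_normal K E"
  note n = outward_normal_edge[OF element_simplex[OF K(1)] K(2)]
  let ?S = "\<Union>{K'\<in>T. x \<notin> K'}"
  have "closed ?S"
  proof (rule closed_Union)
    show "finite {K'\<in>T. x \<notin> K'}" using finite_mesh by simp
    show "\<forall>K'\<in>{K'\<in>T. x \<notin> K'}. closed K'"
      using triangle_props(3)[OF element_simplex] by blast
  qed
  then have "open (\<Omega> - ?S)" using open_domain by (rule open_Diff[rotated])
  moreover have "((\<lambda>s. x + s *\<^sub>R ?n) \<longlongrightarrow> x + 0 *\<^sub>R ?n) (at_right 0)" by (intro tendsto_intros)
  ultimately have "\<forall>\<^sub>F s in at_right 0. x + s *\<^sub>R ?n \<in> \<Omega> - ?S"
    using x(2) by (intro topological_tendstoD) auto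
  moreover have "\<forall>\<^sub>F s in at_right (0::real). 0 < s" by (simp add: eventually_at_right_less)
  ultimately have "\<forall>\<^sub>F s in at_right 0. 0 < s \<and> x + s *\<^sub>R ?n \<in> \<Omega> - ?S"
    by eventually_elim simp
  then obtain s where s: "0 < s" "x + s *\<^sub>R ?n \<in> \<Omega>" "x + s *\<^sub>R ?n \<notin> ?S"
    using eventually_happens'[OF trivial_limit_at_right_real] by blast
  then obtain K' where K': "K' \<in> T" "x + s *\<^sub>R ?n \<in> K'" "x \<in> K'"
    using Union_mesh closure_subset by blast
  have E: "E \<in> element_edges K'" by (rule edge_of_touching_element[OF K x(1) K'(1,3)])
  have "x \<in> E" using x(1) rel_interior_subset by blast
  then have "(x + s *\<^sub>R ?n - x) \<bullet> outward_normal K' E \<le> 0"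
    using outward_normal_edge(3)[OF element_simplex[OF K'(1)] E] K'(2) by blast
  then have "outward_normal K' E \<noteq> ?n"
    using s(1) n(1) by (auto simp: norm_eq_1 mult_le_0_iff)
  moreover have "outward_normal K' E = ?n \<or> outward_normal K' E = - ?n"
    using outward_normal_cases[OF element_simplex[OF K'(1)] E n(1)] n(2) by blast
  ultimately show ?thesis using that K'(1) E by blast
qed

text \<open>Edges lie in the closure of the domain. If the relative interior missed the open domain
  it would lie in the frontier, and so would its closure \<open>E\<close>.\<close>

lemma interior_edge_point:
  assumes "K \<in> T" "E \<in> element_edges K" "\<not> E \<subseteq> frontier \<Omega>"
  obtains x where "x \<in> rel_interior E" "x \<in> \<Omega>"
proof (rule ccontr)
  note e = element_edge_props[OF element_simplex[OF assms(1)] assms(2)]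
  assume "\<not> thesis"
  then have "rel_interior E \<inter> \<Omega> = {}" using that by blast
  moreover have "E \<subseteq> closure \<Omega>" using e(2) assms(1) Union_mesh by blast
  ultimately have "rel_interior E \<subseteq> frontier \<Omega>"
    using rel_interior_subset open_domain by (auto simp: frontier_def interior_open)
  then have "closure (rel_interior E) \<subseteq> frontier \<Omega>" by (simp add: closure_minimal)
  moreover have "closure (rel_interior E) = E"
    using e(3,4) by (simp add: convex_closure_rel_interior compact_imp_closed)
  ultimately show False using assms(3) by simp
qed

text \<open>An edge has only two unit normals, and at most one element belongs to each of
  them.\<close>

lemma interior_edge_elements:
  assumes "K \<in> T" "E \<in> element_edges K" "\<not> E \<subseteq> frontier \<Omega>"
  obtains K' where "K' \<noteq> K" "{K\<in>T. E \<in> element_edges K} = {K, K'}"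
    "outward_normal K' E = - outward_normal K E"
proof -
  obtain x where x: "x \<in> rel_interior E" "x \<in> \<Omega>" using interior_edge_point[OF assms] .
  obtain K' where K': "K' \<in> T" "E \<in> element_edges K'" "outward_normal K' E = - outward_normal K E"
    using opposite_element[OF assms(1,2) x] .
  note n = outward_normal_edge[OF element_simplex[OF assms(1)] assms(2)]
  have ne: "K' \<noteq> K"
  proof
    assume "K' = K"
    have "outward_normal K E = - outward_normal K E" using K'(3) unfolding \<open>K' = K\<close> .
    from arg_cong[OF this, of "\<lambda>z. z \<bullet> outward_normal K E"]
    have "outward_normal K E \<bullet> outward_normal K E = - (outward_normal K E \<bullet> outward_normal K E)"
      by (simp only: inner_minus_left)
    then show False using n(1) by (simp add: norm_eq_1)
  qed
  have "L = K \<or> L = K'" if L: "L \<in> T" "E \<in> element_edges L" for L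
  proof -
    have "outward_normal L E = outward_normal K E \<or> outward_normal L E = - outward_normal K E"
      using outward_normal_cases[OF element_simplex[OF L(1)] L(2) n(1)] n(2) by blast
    then show ?thesis
      using element_eq_if_same_side[OF L assms(1,2)] element_eq_if_same_side[OF L K'(1,2)] K'(3) by auto
  qed
  then have "{K\<in>T. E \<in> element_edges K} = {K, K'}" using assms(1,2) K'(1,2) by auto
  with ne K'(3) that show ?thesis by blast
qed

section \<open>Sums and integrals over the mesh\<close>

lemma finite_element_edges:
  assumes "K \<in> T"
  shows "finite (element_edges K)"
proof -
  obtain a b c where "\<not> collinear {a, b, c}" "K = convex hull {a, b, c}"
    using triangle_simplexE[OF element_simplex[OF assms]] .
  then show ?thesis by (simp add: element_edges_triangle)
qed

lemma finite_mesh_edges: "finite (mesh_edges T)"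
  by (simp add: mesh_edges_def finite_mesh finite_element_edges)

lemma mesh_edgeE:
  assumes "E \<in> mesh_edges T"
  obtains K where "K \<in> T" "E \<in> element_edges K"
  using assms by (auto simp: mesh_edges_def)

lemma sum_elements_edges:
  "(\<Sum>K\<in>T. \<Sum>E\<in>element_edges K. h K E) = (\<Sum>E\<in>mesh_edges T. \<Sum>K | K \<in> T \<and> E \<in> element_edges K. h K E)"
proof -
  have "(\<Sum>K\<in>T. \<Sum>E\<in>element_edges K. h K E) = (\<Sum>K\<in>T. \<Sum>E | E \<in> mesh_edges T \<and> E \<in> element_edges K. h K E)"
    by (intro sum.cong refl) (auto simp: mesh_edges_def)
  also have "\<dots> = (\<Sum>E\<in>mesh_edges T. \<Sum>K | K \<in> T \<and> E \<in> element_edges K. h K E)"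
    by (rule sum.swap_restrict[OF finite_mesh finite_mesh_edges])
  finally show ?thesis .
qed

text \<open>Element boundaries form a null set and element interiors are disjoint, so the arbitrary
  values of a representative on the edges do not enter.\<close>

lemma mesh_integral:
  fixes f :: "real^2 \<Rightarrow> 'b::euclidean_space"
  assumes g: "\<And>K. K \<in> T \<Longrightarrow> continuous_on UNIV (g K)"
    and fg: "\<And>K x. K \<in> T \<Longrightarrow> x \<in> interior K \<Longrightarrow> f x = g K x"
  shows "integrable (lebesgue_on \<Omega>) f"
    and "(LINT x|lebesgue_on \<Omega>. f x) = (\<Sum>K\<in>T. integral K (g K))"
proof -
  let ?U = "\<Union>K\<in>T. interior K"
  have cl: "closure (interior K) = K" "closed K" "convex K" "compact K" if "K \<in> T" for K
    using triangle_props[OF element_simplex[OF that]] by simp_all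
  have neg: "negligible (\<Omega> - ?U)"
  proof (rule negligible_subset)
    show "negligible (\<Union>(frontier ` T))"
      using finite_mesh negligible_convex_frontier cl(3) by (intro negligible_Union) auto
    show "\<Omega> - ?U \<subseteq> \<Union>(frontier ` T)"
    proof
      fix x assume x: "x \<in> \<Omega> - ?U"
      then obtain K where "K \<in> T" "x \<in> K" using Union_mesh closure_subset by blast
      with x show "x \<in> \<Union>(frontier ` T)" using closure_subset by (auto simp: frontier_def)
    qed
  qed
  have spike: "negligible {x \<in> ?U - \<Omega>. f x \<noteq> 0}" "negligible {x \<in> \<Omega> - ?U. f x \<noteq> 0}"
  proof -
    have "{x \<in> ?U - \<Omega>. f x \<noteq> 0} = {}" using interior_element_subset by blast
    then show "negligible {x \<in> ?U - \<Omega>. f x \<noteq> 0}" by (simp only: negligible_empty)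
    show "negligible {x \<in> \<Omega> - ?U. f x \<noteq> 0}" by (rule negligible_subset[OF neg]) blast
  qed
  have aiK: "g K absolutely_integrable_on K" if "K \<in> T" for K
    using cl(4)[OF that] continuous_on_subset[OF g[OF that]]
    by (intro absolutely_integrable_continuous_compact) auto
  have ai: "f absolutely_integrable_on interior K" if K: "K \<in> T" for K
  proof -
    have "g K absolutely_integrable_on interior K"
      by (rule set_integrable_subset[OF aiK[OF K] _ interior_subset]) (simp add: borel_open)
    moreover have "f absolutely_integrable_on interior K \<longleftrightarrow> g K absolutely_integrable_on interior K"
      by (rule set_integrable_cong) (simp_all add: fg[OF K])
    ultimately show ?thesis by simp
  qed
  have "f absolutely_integrable_on ?U"
    by (rule set_integrable_UN[OF finite_mesh ai]) (simp_all add: borel_open)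
  then have aiO: "f absolutely_integrable_on \<Omega>"
    using absolutely_integrable_spike_set_eq[OF spike] by simp
  have Ol: "\<Omega> \<in> sets lebesgue" using open_domain by (simp add: borel_open)
  show int: "integrable (lebesgue_on \<Omega>) f"
    using aiO Ol by (simp add: set_integrable_def integrable_restrict_space)
  have hi: "(f has_integral integral K (g K)) (interior K)" if K: "K \<in> T" for K
  proof -
    have hK: "(g K has_integral integral K (g K)) K"
      using aiK[OF K] by (simp add: integrable_integral set_lebesgue_integral_eq_integral(1))
    have "negligible {x \<in> K - interior K. g K x \<noteq> 0}"
      by (rule negligible_subset[OF negligible_convex_frontier[OF cl(3)[OF K]]])
        (use closure_subset in \<open>auto simp: frontier_def\<close>)
    moreover have "{x \<in> interior K - K. g K x \<noteq> 0} = {}" using interior_subset by blast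
    then have "negligible {x \<in> interior K - K. g K x \<noteq> 0}" by (simp only: negligible_empty)
    ultimately have "(g K has_integral integral K (g K)) (interior K)"
      using has_integral_spike_set_eq hK by blast
    then show ?thesis by (rule has_integral_eq[rotated]) (simp add: fg[OF K])
  qed
  have "(f has_integral (\<Sum>K\<in>T. integral K (g K))) ?U"
  proof (rule has_integral_UN[OF finite_mesh hi])
    show "pairwise (\<lambda>K K'. negligible (interior K \<inter> interior K')) T"
      unfolding pairwise_def
    proof (intro ballI impI)
      fix K K' assume K: "K \<in> T" "K' \<in> T" "K \<noteq> K'"
      then have "interior K \<inter> interior K' = {}"
        using element_eq_if_interior[of K K'] interior_subset by blast
      then show "negligible (interior K \<inter> interior K')" by simp
    qed
  qed
  then have "(f has_integral (\<Sum>K\<in>T. integral K (g K))) \<Omega>"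
    using has_integral_spike_set_eq[OF spike] by simp
  then show "(LINT x|lebesgue_on \<Omega>. f x) = (\<Sum>K\<in>T. integral K (g K))"
    using lebesgue_integral_eq_integral[OF int Ol] by (simp add: integral_unique)
qed

end

section \<open>Weak divergence and flux continuity\<close>

lemma edge_mean_cong:
  assumes "continuous_on UNIV \<phi>" "continuous_on UNIV \<psi>" "E = closed_segment a b"
    and "\<And>x. x \<in> E \<Longrightarrow> \<phi> x = \<psi> x"
  shows "edge_mean \<phi> E = edge_mean \<psi> E"
proof -
  have "a + t *\<^sub>R (b - a) \<in> E" if "t \<in> {0..1}" for t
    using that unfolding assms(3) in_segment by (intro exI[of _ t]) (simp add: algebra_simps)
  then show ?thesis
    unfolding assms(3) edge_mean_segment[OF assms(1)] edge_mean_segment[OF assms(2)]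
    using assms(3,4) by (intro Henstock_Kurzweil_Integration.integral_cong) blast
qed

text \<open>A continuous nonnegative function with integral zero vanishes identically.\<close>

lemma edge_mean_pos:
  assumes \<phi>: "continuous_on UNIV \<phi>" and E: "E = closed_segment a b"
    and nonneg: "\<And>x. 0 \<le> \<phi> x" and x: "x \<in> E" "0 < \<phi> x"
  shows "0 < edge_mean \<phi> E"
proof -
  let ?f = "\<lambda>t. \<phi> (a + t *\<^sub>R (b - a))"
  have c: "continuous_on {0..1} ?f"
    by (rule continuous_on_compose2[OF \<phi>]) (auto intro!: continuous_intros)
  obtain u where u: "u \<in> {0..1}" "x = a + u *\<^sub>R (b - a)"
    using x(1) E by (auto simp: in_segment algebra_simps)
  have "integral {0..1} ?f \<noteq> 0"
    using integral_eq_0_iff[OF c] nonneg u x(2) by fastforce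
  moreover have "0 \<le> integral {0..1} ?f"
    using nonneg by (intro Henstock_Kurzweil_Integration.integral_nonneg integrable_continuous_interval c)
  ultimately show ?thesis unfolding E edge_mean_segment[OF \<phi>] by simp
qed

text \<open>Squaring removes the kink of the positive part at 0, which gives cut-off functions the
  continuous gradient demanded of test functions.\<close>

lemma DERIV_max_0_square: "((\<lambda>z::real. (max 0 z)\<^sup>2) has_real_derivative 2 * max 0 z) (at z)"
proof (cases z "0::real" rule: linorder_cases)
  case less
  show ?thesis
    by (rule has_field_derivative_transform_within_open[where S = "{..<0}" and f = "\<lambda>_. 0"])
      (use less in auto)
next
  case greater
  show ?thesis
    by (rule has_field_derivative_transform_within_open[where S = "{0<..}" and f = "\<lambda>z. z\<^sup>2"])
      (use greater in \<open>auto intro!: derivative_eq_intros\<close>)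
next
  case equal
  have "((\<lambda>h::real. (max 0 h)\<^sup>2 / h) \<longlongrightarrow> 0) (at 0)"
  proof (rule Lim_null_comparison)
    show "\<forall>\<^sub>F h in at (0::real). norm ((max 0 h)\<^sup>2 / h) \<le> \<bar>h\<bar>"
      by (auto simp: eventually_at_filter max_def power2_eq_square)
    show "((\<lambda>h::real. \<bar>h\<bar>) \<longlongrightarrow> 0) (at 0)" by (rule tendsto_rabs_zero) (rule tendsto_ident_at)
  qed
  then show ?thesis by (simp add: equal DERIV_def)
qed

text \<open>The witness is the squared positive part of
  \<open>r\<^sup>2 - (y - x) \<bullet> (y - x)\<close>. It is largest at \<open>x\<close>, where it
  equals \<open>r ^ 4\<close>; this bound later provides the dominating function.\<close>

lemma bump_function:
  fixes x :: "'a::real_inner"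
  assumes "r > 0"
  obtains \<phi> G where "\<And>y. GDERIV \<phi> y :> G y" "continuous_on UNIV G" "\<And>y. 0 \<le> \<phi> y"
    "0 < \<phi> x" "\<And>y. y \<notin> cball x r \<Longrightarrow> \<phi> y = 0" "\<And>y. \<phi> y \<le> r ^ 4"
proof -
  define w where "w = (\<lambda>y. r\<^sup>2 - (y - x) \<bullet> (y - x))"
  define \<phi> where "\<phi> = (\<lambda>y. (max 0 (w y))\<^sup>2)"
  define G where "G = (\<lambda>y. (- 4 * max 0 (w y)) *\<^sub>R (y - x))"
  have cw: "continuous_on UNIV w" unfolding w_def by (intro continuous_intros)
  have dw: "GDERIV w y :> (- 2) *\<^sub>R (y - x)" for y
    unfolding gderiv_def w_def by (auto intro!: derivative_eq_intros simp: inner_commute)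
  have "GDERIV \<phi> y :> G y" for y
    using GDERIV_DERIV_compose[OF dw DERIV_max_0_square, of y] by (simp add: \<phi>_def G_def)
  moreover have "continuous_on UNIV G"
    unfolding G_def by (intro continuous_intros cw)
  moreover have "0 < \<phi> x" using assms by (simp add: \<phi>_def w_def)
  moreover have "\<phi> y = 0" if "y \<notin> cball x r" for y
  proof -
    have "r < norm (y - x)" using that by (simp add: dist_norm norm_minus_commute)
    then have "r\<^sup>2 \<le> (norm (y - x))\<^sup>2" using assms by (intro power_mono) auto
    then show ?thesis by (simp add: \<phi>_def w_def power2_norm_eq_inner)
  qed
  moreover have "\<phi> y \<le> r ^ 4" for y
  proof -
    have "(max 0 (w y))\<^sup>2 \<le> (r\<^sup>2)\<^sup>2" by (intro power_mono) (auto simp: w_def)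
    then show ?thesis by (simp add: \<phi>_def)
  qed
  ultimately show ?thesis using that[of \<phi> G] by (simp add: \<phi>_def)
qed

lemma L2_integrable:
  fixes f :: "real^2 \<Rightarrow> real"
  assumes "f \<in> L2 S" "bounded S" "S \<in> sets lebesgue"
  shows "integrable (lebesgue_on S) f"
proof (rule Bochner_Integration.integrable_bound)
  have "S \<in> lmeasurable" using assms(2,3) by (simp add: bounded_set_imp_lmeasurable)
  then have "integrable (lebesgue_on S) (\<lambda>x. 1 :: real)"
    using assms(3) by (simp add: integrable_restrict_space lmeasurable_iff_integrable)
  then show "integrable (lebesgue_on S) (\<lambda>x. 1 + (norm (f x))\<^sup>2)"
    using assms(1) unfolding L2_def by (intro Bochner_Integration.integrable_add) auto
  show "f \<in> borel_measurable (lebesgue_on S)" using assms(1) by (simp add: L2_def)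
  \<comment> \<open>A consequence of (|t| - 1)^2 being nonnegative.\<close>
  have "norm t \<le> norm (1 + (norm t)\<^sup>2)" for t :: real
    using sum_power2_ge_zero[of "\<bar>t\<bar> - 1" 0] by (simp add: power2_eq_square algebra_simps) 
  then show "AE x in lebesgue_on S. norm (f x) \<le> norm (1 + (norm (f x))\<^sup>2)" by simp
qed

lemma RT0_normal_trace:
  assumes K: "2 simplex K" and E: "E \<in> element_edges K" and x: "x \<in> E"
    and v: "\<And>y. y \<in> interior K \<Longrightarrow> v y = a + b *\<^sub>R y"
  shows "trace_from K v x = a + b *\<^sub>R x"
    and "normal_trace K E v x = (a + b *\<^sub>R barycenter E) \<bullet> outward_normal K E"
proof -
  note e = element_edge_props[OF K E]
  show tr: "trace_from K v x = a + b *\<^sub>R x"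
    using e(2) x by (intro trace_from_eq[OF K _ _ v] continuous_intros) auto
  show "normal_trace K E v x = (a + b *\<^sub>R barycenter E) \<bullet> outward_normal K E"
    unfolding normal_trace_def tr by (rule RT0_normal_component[OF K E x e(1)])
qed

section \<open>Elementwise Raviart-Thomas fields and their flux jumps\<close>

context triangulated_domain
begin

text \<open>At most one element has a given point in its interior. Outside the element interiors the
  value is unspecified, which within the domain concerns only a null set.\<close>

definition piecewise :: "((real^2) set \<Rightarrow> real^2 \<Rightarrow> 'b) \<Rightarrow> real^2 \<Rightarrow> 'b" where
  "piecewise g x = g (THE K. K \<in> T \<and> x \<in> interior K) x"

lemma piecewise_eq:
  assumes "K \<in> T" "x \<in> interior K"
  shows "piecewise g x = g K x"
proof -
  have "(THE K. K \<in> T \<and> x \<in> interior K) = K"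
    using assms element_eq_if_interior interior_subset by (intro the_equality) blast+
  then show ?thesis by (simp add: piecewise_def)
qed

lemma piecewise_continuous_L2:
  fixes f :: "real^2 \<Rightarrow> 'b::euclidean_space"
  assumes g: "\<And>K. K \<in> T \<Longrightarrow> continuous_on UNIV (g K)"
    and fg: "\<And>K x. K \<in> T \<Longrightarrow> x \<in> interior K \<Longrightarrow> f x = g K x"
  shows "f \<in> L2 \<Omega>"
proof -
  have "integrable (lebesgue_on \<Omega>) f" by (rule mesh_integral(1)[OF g fg])
  moreover have "integrable (lebesgue_on \<Omega>) (\<lambda>x. (norm (f x))\<^sup>2)"
    by (rule mesh_integral(1)[of "\<lambda>K x. (norm (g K x))\<^sup>2"]) (simp_all add: fg continuous_intros g)
  ultimately show ?thesis by (simp add: L2_def)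
qed

text \<open>A sum and not a difference, because the outward normals of two neighbours are
  opposite.\<close>

definition flux_jump :: "(real^2 \<Rightarrow> real^2) \<Rightarrow> (real^2) set \<Rightarrow> real" where
  "flux_jump v E = (\<Sum>K | K \<in> T \<and> E \<in> element_edges K. normal_trace K E v (barycenter E))"

text \<open>The identities on the elements are added up. The length and the edge mean are the same
  from both sides, so they factor out of the normal components. The right side measures how far the
  elementwise divergence is from being a weak divergence.\<close>

lemma piecewise_RT0_divergence:
  assumes v: "\<And>K x. K \<in> T \<Longrightarrow> x \<in> interior K \<Longrightarrow> v x = \<alpha> K + \<beta> K *\<^sub>R x"
    and d: "\<And>y. GDERIV \<phi> y :> G y" and G: "continuous_on UNIV G"
  shows "(LINT x|lebesgue_on \<Omega>. v x \<bullet> G x)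
      + (LINT x|lebesgue_on \<Omega>. piecewise (\<lambda>K x. 2 * \<beta> K) x * \<phi> x)
    = (\<Sum>E\<in>mesh_edges T. diameter E * edge_mean \<phi> E * flux_jump v E)"
proof -
  note c\<phi> = GDERIV_continuous[OF d]
  have 1: "continuous_on UNIV (\<lambda>x. (\<alpha> K + \<beta> K *\<^sub>R x) \<bullet> G x)" "continuous_on UNIV (\<lambda>x. 2 * \<beta> K * \<phi> x)" for K
    by (intro continuous_intros G c\<phi>)+
  have e1: "v x \<bullet> G x = (\<alpha> K + \<beta> K *\<^sub>R x) \<bullet> G x" if "K \<in> T" "x \<in> interior K" for K x
    by (simp add: v[OF that])
  have e2: "piecewise (\<lambda>K x. 2 * \<beta> K) x * \<phi> x = 2 * \<beta> K * \<phi> x" if "K \<in> T" "x \<in> interior K" for K x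
    by (simp add: piecewise_eq[OF that])
  have int: "h integrable_on K" if "continuous_on UNIV h" "K \<in> T" for h :: "real^2 \<Rightarrow> real" and K
    using that by (intro set_lebesgue_integral_eq_integral(1) absolutely_integrable_continuous_compact
        triangle_props(1)[OF element_simplex]) (auto intro: continuous_on_subset)
  have "(LINT x|lebesgue_on \<Omega>. v x \<bullet> G x)
      + (LINT x|lebesgue_on \<Omega>. piecewise (\<lambda>K x. 2 * \<beta> K) x * \<phi> x)
    = (\<Sum>K\<in>T. integral K (\<lambda>x. (\<alpha> K + \<beta> K *\<^sub>R x) \<bullet> G x) + integral K (\<lambda>x. 2 * \<beta> K * \<phi> x))"
    by (subst mesh_integral(2)[of "\<lambda>K x. (\<alpha> K + \<beta> K *\<^sub>R x) \<bullet> G x", OF 1(1) e1], assumption, assumption,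
        subst mesh_integral(2)[of "\<lambda>K x. 2 * \<beta> K * \<phi> x", OF 1(2) e2])
      (simp_all add: sum.distrib)
  also have "\<dots> = (\<Sum>K\<in>T. integral K (\<lambda>x. (\<alpha> K + \<beta> K *\<^sub>R x) \<bullet> G x + 2 * \<beta> K * \<phi> x))"
    by (intro sum.cong refl Henstock_Kurzweil_Integration.integral_add[symmetric] int 1)
  also have "\<dots> = (\<Sum>K\<in>T. \<Sum>E\<in>element_edges K. diameter E * normal_trace K E v (barycenter E) * edge_mean \<phi> E)"
  proof (rule sum.cong[OF refl])
    fix K assume K: "K \<in> T"
    have "normal_trace K E v (barycenter E) = (\<alpha> K + \<beta> K *\<^sub>R barycenter E) \<bullet> outward_normal K E"
      if "E \<in> element_edges K" for E
      using RT0_normal_trace(2)[OF element_simplex[OF K] that _ v[OF K]] element_edge_props(1)[OF element_simplex[OF K] that]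
      by blast
    then show "integral K (\<lambda>x. (\<alpha> K + \<beta> K *\<^sub>R x) \<bullet> G x + 2 * \<beta> K * \<phi> x)
      = (\<Sum>E\<in>element_edges K. diameter E * normal_trace K E v (barycenter E) * edge_mean \<phi> E)"
      unfolding triangle_divergence_RT0[OF element_simplex[OF K] d G] by simp
  qed
  also have "\<dots> = (\<Sum>E\<in>mesh_edges T. diameter E * edge_mean \<phi> E * flux_jump v E)"
    unfolding sum_elements_edges flux_jump_def sum_distrib_left by (intro sum.cong refl) (simp add: mult_ac)
  finally show ?thesis .
qed

lemma mesh_edge_segmentE:
  assumes "E \<in> mesh_edges T"
  obtains a b where "E = closed_segment a b" "a \<noteq> b"
  using assms by (metis element_simplex mesh_edgeE noncollinear_simps(1) triangle_edgeE)

text \<open>The elementwise divergence is the weak one: interior edges drop out by hypothesis, edges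
  in the frontier because a test function vanishes outside a subset of the open domain.\<close>

lemma H_div_if_flux_jump_0:
  assumes v: "\<And>K x. K \<in> T \<Longrightarrow> x \<in> interior K \<Longrightarrow> v x = \<alpha> K + \<beta> K *\<^sub>R x"
    and j: "\<And>E. E \<in> mesh_edges T \<Longrightarrow> \<not> E \<subseteq> frontier \<Omega> \<Longrightarrow> flux_jump v E = 0"
  shows "v \<in> H_div \<Omega>"
proof -
  let ?g = "piecewise (\<lambda>K x. 2 * \<beta> K)"
  have "v \<in> L2 \<Omega>"
    by (rule piecewise_continuous_L2[of "\<lambda>K x. \<alpha> K + \<beta> K *\<^sub>R x", OF _ v]) (intro continuous_intros)
  moreover have "?g \<in> L2 \<Omega>"
    by (rule piecewise_continuous_L2[of "\<lambda>K x. 2 * \<beta> K", OF _ piecewise_eq]) (intro continuous_intros)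
  moreover have "has_weak_divergence \<Omega> v ?g"
    unfolding has_weak_divergence_def
  proof (intro allI impI, elim conjE exE)
    fix \<phi> G S
    assume d: "\<forall>x. GDERIV \<phi> x :> G x" and G: "continuous_on UNIV G"
      and S: "S \<subseteq> \<Omega>" "\<forall>x. x \<notin> S \<longrightarrow> \<phi> x = 0"
    have c\<phi>: "continuous_on UNIV \<phi>" using GDERIV_continuous d by blast
    have "diameter E * edge_mean \<phi> E * flux_jump v E = 0" if E: "E \<in> mesh_edges T" for E
    proof (cases "E \<subseteq> frontier \<Omega>")
      case True
      obtain a b where ab: "E = closed_segment a b" using mesh_edge_segmentE[OF E] .
      have "\<phi> x = 0" if "x \<in> E" for x
        using True that S open_domain by (auto simp: frontier_def interior_open)
      then have "edge_mean \<phi> E = edge_mean (\<lambda>_. 0) E"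
        by (intro edge_mean_cong[OF c\<phi> _ ab]) auto
      also have "\<dots> = 0" unfolding ab by (subst edge_mean_segment) auto
      finally show ?thesis by simp
    qed (simp add: j E)
    then have "(\<Sum>E\<in>mesh_edges T. diameter E * edge_mean \<phi> E * flux_jump v E) = 0"
      by (intro sum.neutral) blast
    moreover have "(LINT x|lebesgue_on \<Omega>. v x \<bullet> G x) + (LINT x|lebesgue_on \<Omega>. ?g x * \<phi> x)
        = (\<Sum>E\<in>mesh_edges T. diameter E * edge_mean \<phi> E * flux_jump v E)"
      by (rule piecewise_RT0_divergence[OF v d[rule_format] G])
    ultimately show "(LINT x|lebesgue_on \<Omega>. v x \<bullet> G x) = - (LINT x|lebesgue_on \<Omega>. ?g x * \<phi> x)"
      by simp
  qed
  ultimately show ?thesis unfolding H_div_def by blast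
qed

text \<open>Test functions \<open>\<phi> / (1 + k ((y - x) \<bullet> n)\<^sup>2)\<close>, with \<open>\<phi>\<close> a bump at an inner point \<open>x\<close> of the edge, do
  not depend on \<open>k\<close> on the edge but tend to \<open>0\<close> off its line, so only the edge term survives.\<close>

lemma flux_jump_0_if_H_div:
  assumes v: "\<And>K x. K \<in> T \<Longrightarrow> x \<in> interior K \<Longrightarrow> v x = \<alpha> K + \<beta> K *\<^sub>R x"
    and H: "v \<in> H_div \<Omega>" and E: "E \<in> mesh_edges T" "\<not> E \<subseteq> frontier \<Omega>"
  shows "flux_jump v E = 0"
proof -
  obtain K where K: "K \<in> T" "E \<in> element_edges K" using mesh_edgeE[OF E(1)] .
  note n = outward_normal_edge[OF element_simplex[OF K(1)] K(2)]
  let ?n = "outward_normal K E"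
  let ?g = "piecewise (\<lambda>K x. 2 * \<beta> K)"
  obtain h where h: "h \<in> L2 \<Omega>" "has_weak_divergence \<Omega> v h" using H by (auto simp: H_div_def)
  have g: "?g \<in> L2 \<Omega>"
    by (rule piecewise_continuous_L2[of "\<lambda>K x. 2 * \<beta> K", OF _ piecewise_eq]) (intro continuous_intros)
  have Ol: "\<Omega> \<in> sets lebesgue" using open_domain by (simp add: borel_open)
  note ih = L2_integrable[OF h(1) bounded_domain Ol] and ig = L2_integrable[OF g bounded_domain Ol]
  obtain x where x: "x \<in> rel_interior E" "x \<in> \<Omega>" using interior_edge_point[OF K E(2)] .
  have xE: "x \<in> E" using x(1) rel_interior_subset by blast
  let ?S = "\<Union>(mesh_edges T - {E})"
  have "closed ?S"
  proof (rule closed_Union)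
    show "finite (mesh_edges T - {E})" using finite_mesh_edges by simp
    show "\<forall>E'\<in>mesh_edges T - {E}. closed E'"
      by (metis DiffD1 closed_segment mesh_edge_segmentE)
  qed
  then have "open (\<Omega> - ?S)" using open_domain by (rule open_Diff[rotated])
  \<comment> \<open>An inner point of \<open>E\<close> lies on no other edge, so a bump with small
    support reduces the sum over all edges to the term of \<open>E\<close>.\<close>
  moreover have "x \<notin> ?S"
    using edge_eq_if_meets_rel_interior[OF K x(1)] by (auto elim!: mesh_edgeE)
  ultimately obtain r where r: "r > 0" "cball x r \<subseteq> \<Omega> - ?S"
    using x(2) open_contains_cball_eq by (metis DiffI)
  obtain \<phi> G where d: "\<And>y. GDERIV \<phi> y :> G y" and G: "continuous_on UNIV G"
    and \<phi>: "\<And>y. 0 \<le> \<phi> y" "0 < \<phi> x" "\<And>y. y \<notin> cball x r \<Longrightarrow> \<phi> y = 0" "\<And>y. \<phi> y \<le> r ^ 4"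
    by (rule bump_function[OF r(1), of x]) blast
  note c\<phi> = GDERIV_continuous[OF d]
  define q where "q = (\<lambda>(k::nat) y. 1 + real k * ((y - x) \<bullet> ?n)\<^sup>2)"
  have q: "1 \<le> q k y" for k y by (simp add: q_def)
  then have q0: "q k y \<noteq> 0" for k y using not_one_le_zero by metis
  define \<Phi> where "\<Phi> = (\<lambda>k y. \<phi> y / q k y)"
  define \<Gamma> where "\<Gamma> = (\<lambda>k y. (1 / q k y) *\<^sub>R G y - (\<phi> y * (2 * real k * ((y - x) \<bullet> ?n)) / (q k y)\<^sup>2) *\<^sub>R ?n)"
  have cq: "continuous_on UNIV (q k)" for k unfolding q_def by (intro continuous_intros)
  have d\<Phi>: "GDERIV (\<Phi> k) y :> \<Gamma> k y" for k y
  proof -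
    have dq: "(q k has_derivative (\<lambda>h. 2 * real k * ((y - x) \<bullet> ?n) * (h \<bullet> ?n))) (at y)"
      unfolding q_def by (auto intro!: derivative_eq_intros simp: mult_ac)
    have "(\<Phi> k has_derivative (\<lambda>h. ((h \<bullet> G y) * q k y - \<phi> y * (2 * real k * ((y - x) \<bullet> ?n) * (h \<bullet> ?n))) / (q k y * q k y))) (at y)"
      unfolding \<Phi>_def by (rule has_derivative_divide'[OF d[unfolded gderiv_def] dq q0])
    then show ?thesis
      unfolding gderiv_def
      by (rule has_derivative_eq_rhs)
        (simp add: \<Gamma>_def fun_eq_iff inner_diff_right q0 field_simps power2_eq_square)
  qed
  have c\<Gamma>: "continuous_on UNIV (\<Gamma> k)" for k
    unfolding \<Gamma>_def by (intro continuous_intros c\<phi> cq G) (simp_all add: q0)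
  note c\<Phi> = GDERIV_continuous[OF d\<Phi>]
  have \<Phi>0: "\<Phi> k y = 0" if "y \<notin> cball x r" for k y using \<phi>(3)[OF that] by (simp add: \<Phi>_def)
  have \<Phi>b: "0 \<le> \<Phi> k y" "\<Phi> k y \<le> r ^ 4" for k y
  proof -
    show "0 \<le> \<Phi> k y" using \<phi>(1)[of y] q[of k y] by (simp add: \<Phi>_def)
    have "\<Phi> k y \<le> \<phi> y" unfolding \<Phi>_def
      using mult_left_mono[OF q[of k y] \<phi>(1)[of y]] q[of k y] by (simp add: divide_le_eq)
    then show "\<Phi> k y \<le> r ^ 4" using \<phi>(4)[of y] by linarith
  qed
  have m\<Phi>: "\<Phi> k \<in> borel_measurable (lebesgue_on \<Omega>)" for k
    by (rule continuous_imp_measurable_on_sets_lebesgue[OF continuous_on_subset[OF c\<Phi>] Ol]) simp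
  have i\<Phi>: "integrable (lebesgue_on \<Omega>) (\<lambda>y. f y * \<Phi> k y)" if f: "integrable (lebesgue_on \<Omega>) f" for f k
  proof (rule Bochner_Integration.integrable_bound)
    show "integrable (lebesgue_on \<Omega>) (\<lambda>y. f y * r ^ 4)" using f by simp
    show "(\<lambda>y. f y * \<Phi> k y) \<in> borel_measurable (lebesgue_on \<Omega>)" using f m\<Phi> by measurable
    show "AE y in lebesgue_on \<Omega>. norm (f y * \<Phi> k y) \<le> norm (f y * r ^ 4)"
      using \<Phi>b r(1) by (intro AE_I2) (auto simp: abs_mult intro!: mult_left_mono)
  qed
  obtain a b where ab: "E = closed_segment a b" using mesh_edge_segmentE[OF E(1)] .
  \<comment> \<open>Here \<open>h\<close> is the given weak divergence and \<open>?g\<close> the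
    elementwise one. The right side is independent of \<open>k\<close>, so the limit 0 of the left
    side forces it to vanish.\<close>
  have "(LINT y|lebesgue_on \<Omega>. (?g y - h y) * \<Phi> k y) = diameter E * edge_mean \<phi> E * flux_jump v E" for k
  proof -
    have "(LINT y|lebesgue_on \<Omega>. v y \<bullet> \<Gamma> k y) = - (LINT y|lebesgue_on \<Omega>. h y * \<Phi> k y)"
      using h(2)[unfolded has_weak_divergence_def, rule_format, of "\<Phi> k" "\<Gamma> k"] d\<Phi> c\<Gamma> \<Phi>0 r(2)
      by (metis Diff_subset compact_cball order_trans)
    then have "(LINT y|lebesgue_on \<Omega>. (?g y - h y) * \<Phi> k y)
      = (LINT y|lebesgue_on \<Omega>. v y \<bullet> \<Gamma> k y) + (LINT y|lebesgue_on \<Omega>. ?g y * \<Phi> k y)"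
      using i\<Phi>[OF ih] i\<Phi>[OF ig] by (simp add: left_diff_distrib)
    also have "\<dots> = (\<Sum>E\<in>mesh_edges T. diameter E * edge_mean (\<Phi> k) E * flux_jump v E)"
      by (rule piecewise_RT0_divergence[OF v d\<Phi> c\<Gamma>])
    also have "\<dots> = (\<Sum>E'\<in>mesh_edges T. if E' = E then diameter E * edge_mean \<phi> E * flux_jump v E else 0)"
    proof (rule sum.cong[OF refl])
      fix E' assume E': "E' \<in> mesh_edges T"
      show "diameter E' * edge_mean (\<Phi> k) E' * flux_jump v E'
        = (if E' = E then diameter E * edge_mean \<phi> E * flux_jump v E else 0)"
      proof (cases "E' = E")
        case True
        have "\<Phi> k y = \<phi> y" if "y \<in> E" for y
          using n(2)[OF xE that] by (simp add: \<Phi>_def q_def)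
        then have "edge_mean (\<Phi> k) E = edge_mean \<phi> E" by (rule edge_mean_cong[OF c\<Phi> c\<phi> ab])
        with True show ?thesis by simp
      next
        case False
        obtain a' b' where ab': "E' = closed_segment a' b'" using mesh_edge_segmentE[OF E'] .
        have "\<Phi> k y = 0" if "y \<in> E'" for y
          using \<Phi>0 r(2) that E' False by blast
        then have "edge_mean (\<Phi> k) E' = edge_mean (\<lambda>_. 0) E'"
          by (intro edge_mean_cong[OF c\<Phi> _ ab']) auto
        also have "\<dots> = 0" unfolding ab' by (subst edge_mean_segment) auto
        finally show ?thesis using False by simp
      qed
    qed
    also have "\<dots> = diameter E * edge_mean \<phi> E * flux_jump v E"
      using E(1) finite_mesh_edges by simp
    finally show ?thesis .
  qed
  moreover have "(\<lambda>k. LINT y|lebesgue_on \<Omega>. (?g y - h y) * \<Phi> k y) \<longlonglongrightarrow> (LINT y|lebesgue_on \<Omega>. 0)"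
  proof (rule integral_dominated_convergence[where w = "\<lambda>y. norm ((?g y - h y) * r ^ 4)"])
    have igh: "integrable (lebesgue_on \<Omega>) (\<lambda>y. ?g y - h y)" using ig ih by simp
    show "integrable (lebesgue_on \<Omega>) (\<lambda>y. norm ((?g y - h y) * r ^ 4))" using igh by simp
    show "(\<lambda>y. (?g y - h y) * \<Phi> k y) \<in> borel_measurable (lebesgue_on \<Omega>)" for k
      using i\<Phi>[OF igh] by simp
    show "AE y in lebesgue_on \<Omega>. norm ((?g y - h y) * \<Phi> k y) \<le> norm ((?g y - h y) * r ^ 4)" for k
      using \<Phi>b r(1) by (intro AE_I2) (auto simp: abs_mult intro!: mult_left_mono)
    \<comment> \<open>The line through the edge is a null set; off it, \<open>q k y\<close> grows
      linearly in \<open>k\<close>.\<close>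
    have "negligible {y. ?n \<bullet> y = ?n \<bullet> x}" using n(1) by (intro negligible_hyperplane) auto
    then have "AE y in lebesgue. y \<notin> {y. ?n \<bullet> y = ?n \<bullet> x}"
      by (intro AE_not_in) (simp add: negligible_iff_null_sets)
    then have ae: "AE y in lebesgue_on \<Omega>. y \<notin> {y. ?n \<bullet> y = ?n \<bullet> x}"
      using Ol by (subst AE_restrict_space_iff) (auto elim: eventually_mono)
    have "(\<lambda>k. (?g y - h y) * \<Phi> k y) \<longlonglongrightarrow> 0" if y: "y \<notin> {y. ?n \<bullet> y = ?n \<bullet> x}" for y
    proof -
      have pos: "0 < ((y - x) \<bullet> ?n)\<^sup>2" using y by (simp add: inner_diff_left inner_commute[of ?n])
      have "filterlim (\<lambda>k. q k y) at_top sequentially"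
        unfolding q_def
        by (intro filterlim_tendsto_add_at_top[OF tendsto_const]
            filterlim_at_top_mult_tendsto_pos[OF tendsto_const pos] filterlim_real_sequentially)
      then have "(\<lambda>k. (?g y - h y) * (\<phi> y / q k y)) \<longlonglongrightarrow> (?g y - h y) * 0"
        by (intro tendsto_mult tendsto_const real_tendsto_divide_at_top[OF tendsto_const])
      then show ?thesis by (simp add: \<Phi>_def)
    qed
    then show "AE y in lebesgue_on \<Omega>. (\<lambda>k. (?g y - h y) * \<Phi> k y) \<longlonglongrightarrow> 0"
      using ae by (rule_tac AE_mp) auto
  qed simp
  ultimately have "diameter E * edge_mean \<phi> E * flux_jump v E = 0"
    by (simp add: LIMSEQ_const_iff)
  moreover have "edge_mean \<phi> E > 0" by (rule edge_mean_pos[OF c\<phi> ab \<phi>(1) xE \<phi>(2)])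
  moreover have "diameter E > 0"
    using mesh_edge_segmentE[OF E(1)] by (metis diameter_segment zero_less_dist_iff)
  ultimately show ?thesis by simp
qed

end

section \<open>The finite element spaces\<close>

text \<open>Unisolvence of the edge fluxes. In the basis of vertex fields the system is diagonal: on
  each edge only the field of the opposite vertex has a flux, and that flux is the height over the
  edge, which is nonzero.\<close>

lemma RT0_prescribed_fluxes:
  assumes K: "2 simplex K"
  shows "\<exists>\<alpha> \<beta>. \<forall>E\<in>element_edges K. (\<alpha> + \<beta> *\<^sub>R barycenter E) \<bullet> outward_normal K E = f E"
proof -
  obtain a b c where nc: "\<not> collinear {a, b, c}" and Kabc: "K = convex hull {a, b, c}"
    using triangle_simplexE[OF K] .
  note nc' = noncollinear_simps[OF nc]
  have K1: "K = convex hull {b, c, a}" and K2: "K = convex hull {c, a, b}"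
    using Kabc by (simp_all add: insert_commute)
  define h where "h E p = (barycenter E - p) \<bullet> outward_normal K E" for E p
  have h: "h (closed_segment q r) q = 0" "h (closed_segment q r) r = 0" "h (closed_segment q r) p \<noteq> 0"
    if "\<not> collinear {q, r, p}" "K = convex hull {q, r, p}" for p q r
  proof -
    let ?E = "closed_segment q r"
    have E: "?E \<in> element_edges K" using element_edges_triangle[OF that(1)] that(2) by simp
    show z: "h ?E q = 0" "h ?E r = 0"
      using outward_normal_edge(2)[OF K E] barycenter_segment by (auto simp: h_def)
    have "h ?E p = h ?E q - (p - q) \<bullet> outward_normal K ?E"
      by (simp add: h_def inner_diff_left)
    then show "h ?E p \<noteq> 0"
      using z outward_normal_triangle(3)[OF that(1)] that(2) by simp
  qed
  define ca cb cc where "ca = f (closed_segment b c) / h (closed_segment b c) a"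
    and "cb = f (closed_segment c a) / h (closed_segment c a) b"
    and "cc = f (closed_segment a b) / h (closed_segment a b) c"
  define \<alpha> where "\<alpha> = - (ca *\<^sub>R a + cb *\<^sub>R b + cc *\<^sub>R c)"
  define \<beta> where "\<beta> = ca + cb + cc"
  have "(\<alpha> + \<beta> *\<^sub>R barycenter E) = ca *\<^sub>R (barycenter E - a) + cb *\<^sub>R (barycenter E - b) + cc *\<^sub>R (barycenter E - c)" for E
    by (simp add: \<alpha>_def \<beta>_def algebra_simps)
  then have flux: "(\<alpha> + \<beta> *\<^sub>R barycenter E) \<bullet> outward_normal K E = ca * h E a + cb * h E b + cc * h E c" for E
    by (simp add: h_def inner_add_left)
  have "\<forall>E\<in>element_edges K. (\<alpha> + \<beta> *\<^sub>R barycenter E) \<bullet> outward_normal K E = f E"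
    unfolding flux unfolding element_edges_triangle[OF nc, folded Kabc]
    using h[OF nc Kabc] h[OF nc'(5) K1] h[OF nc'(6) K2]
    by (simp add: ca_def cb_def cc_def)
  then show ?thesis by blast
qed

context triangulated_domain
begin

text \<open>One value per edge suffices, since Raviart-Thomas fields have constant normal components
  on edges.\<close>

definition boundary_flux_0 :: "(real^2 \<Rightarrow> real^2) \<Rightarrow> bool" where
  "boundary_flux_0 v \<longleftrightarrow>
     (\<forall>K\<in>T. \<forall>E\<in>element_edges K. E \<subseteq> frontier \<Omega> \<longrightarrow> normal_trace K E v (barycenter E) = 0)"

text \<open>Trades the distributional condition in \<open>H_div\<close> for finitely many equations
  between edge values; \<open>V_hI\<close> is the converse.\<close>

lemma V_hE:
  assumes "v \<in> V_h \<Omega> T"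
  obtains \<alpha> \<beta> where "\<And>K x. K \<in> T \<Longrightarrow> x \<in> interior K \<Longrightarrow> v x = \<alpha> K + \<beta> K *\<^sub>R x"
    "boundary_flux_0 v" "\<And>E. E \<in> mesh_edges T \<Longrightarrow> \<not> E \<subseteq> frontier \<Omega> \<Longrightarrow> flux_jump v E = 0"
proof -
  have "\<forall>K\<in>T. \<exists>a b. \<forall>x\<in>interior K. v x = a + b *\<^sub>R x" and H: "v \<in> H_div \<Omega>"
    and b: "\<forall>K\<in>T. \<forall>E\<in>element_edges K. E \<subseteq> frontier \<Omega> \<longrightarrow> (\<forall>x\<in>E. normal_trace K E v x = 0)"
    using assms by (auto simp: V_h_def)
  then obtain \<alpha> \<beta> where v: "\<And>K x. K \<in> T \<Longrightarrow> x \<in> interior K \<Longrightarrow> v x = \<alpha> K + \<beta> K *\<^sub>R x" by metis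
  show ?thesis
  proof (rule that[of \<alpha> \<beta>])
    show "v x = \<alpha> K + \<beta> K *\<^sub>R x" if "K \<in> T" "x \<in> interior K" for K x by (rule v[OF that])
    show "boundary_flux_0 v"
      unfolding boundary_flux_0_def using b element_edge_props(1)[OF element_simplex] by blast
    show "flux_jump v E = 0" if "E \<in> mesh_edges T" "\<not> E \<subseteq> frontier \<Omega>" for E
      by (rule flux_jump_0_if_H_div[OF v H that])
  qed
qed

lemma V_hI:
  assumes v: "\<And>K x. K \<in> T \<Longrightarrow> x \<in> interior K \<Longrightarrow> v x = \<alpha> K + \<beta> K *\<^sub>R x"
    and b: "boundary_flux_0 v"
    and j: "\<And>E. E \<in> mesh_edges T \<Longrightarrow> \<not> E \<subseteq> frontier \<Omega> \<Longrightarrow> flux_jump v E = 0"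
  shows "v \<in> V_h \<Omega> T"
proof -
  have "v \<in> H_div \<Omega>" by (rule H_div_if_flux_jump_0[of v \<alpha> \<beta>]) (fact v, fact j)
  moreover have "\<exists>a b. \<forall>x\<in>interior K. v x = a + b *\<^sub>R x" if "K \<in> T" for K
    using v[OF that] by blast
  moreover have "normal_trace K E v x = 0"
    if "K \<in> T" "E \<in> element_edges K" "E \<subseteq> frontier \<Omega>" "x \<in> E" for K E x
  proof -
    have "normal_trace K E v x = normal_trace K E v (barycenter E)"
      using RT0_normal_trace(2)[OF element_simplex[OF that(1)] that(2) _ v[OF that(1)]]
        element_edge_props(1)[OF element_simplex[OF that(1)] that(2)] that(4) by simp
    then show ?thesis using b that by (simp add: boundary_flux_0_def)
  qed
  ultimately show ?thesis by (auto simp: V_h_def)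
qed

lemma edge_elements_cases:
  assumes "K \<in> T" "E \<in> element_edges K"
  obtains (boundary) "E \<subseteq> frontier \<Omega>"
  | (inner) K' where "\<not> E \<subseteq> frontier \<Omega>" "K' \<noteq> K" "{K\<in>T. E \<in> element_edges K} = {K, K'}"
      "outward_normal K' E = - outward_normal K E"
  using interior_edge_elements[OF assms] by metis

text \<open>Between two neighbours the sign of \<open>outward_normal K E \<bullet> nE E\<close>
  flips, and so does the normal trace when the jump is zero. Their product is thus the same from
  every element (on a boundary edge it is 0), and the description in \<open>edge_flux\<close>
  denotes this value.\<close>

lemma normal_trace_edge_flux:
  assumes nE: "unit_edge_normals T nE"
    and v: "\<And>K x. K \<in> T \<Longrightarrow> x \<in> interior K \<Longrightarrow> v x = \<alpha> K + \<beta> K *\<^sub>R x"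
    and b: "boundary_flux_0 v"
    and j: "\<And>E. E \<in> mesh_edges T \<Longrightarrow> \<not> E \<subseteq> frontier \<Omega> \<Longrightarrow> flux_jump v E = 0"
    and K: "K \<in> T" "E \<in> element_edges K"
  shows "normal_trace K E v (barycenter E) = (outward_normal K E \<bullet> nE E) * edge_flux T nE E v"
    and "(outward_normal K E \<bullet> nE E)\<^sup>2 = 1"
proof -
  define s where "s K = outward_normal K E \<bullet> nE E" for K
  define N where "N K = normal_trace K E v (barycenter E)" for K
  have E: "E \<in> mesh_edges T" using K by (auto simp: mesh_edges_def)
  have n1: "norm (nE E) = 1" "\<forall>x\<in>E. \<forall>y\<in>E. (y - x) \<bullet> nE E = 0"
    using nE E by (auto simp: unit_edge_normals_def)
  have s: "(s L)\<^sup>2 = 1 \<and> nE E = s L *\<^sub>R outward_normal L E" if "L \<in> T" "E \<in> element_edges L" for L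
    using outward_normal_cases[OF element_simplex[OF that(1)] that(2) n1] n1(1)
    by (auto simp: s_def norm_eq_1)
  have tr: "trace_from L v x \<bullet> nE E = s L * N L" if L: "L \<in> T" "E \<in> element_edges L" and x: "x \<in> E" for L x
  proof -
    have "trace_from L v x \<bullet> nE E = s L * normal_trace L E v x"
      using s[OF L] by (metis inner_scaleR_right normal_trace_def)
    also have "normal_trace L E v x = N L"
      using RT0_normal_trace(2)[OF element_simplex[OF L(1)] L(2) _ v[OF L(1)]]
        element_edge_props(1)[OF element_simplex[OF L(1)] L(2)] x by (simp add: N_def)
    finally show ?thesis .
  qed
  have same: "s L * N L = s K * N K" if L: "L \<in> T" "E \<in> element_edges L" for L
    using K
  proof (cases rule: edge_elements_cases)
    case boundary
    then show ?thesis using b K L by (simp add: boundary_flux_0_def N_def)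
  next
    case (inner K')
    have "N K + N K' = 0"
      using j[OF E inner(1)] inner(2) by (simp add: flux_jump_def inner(3) N_def)
    moreover have "s K' = - s K" by (simp add: s_def inner(4))
    moreover have "L = K \<or> L = K'" using L inner(3) by blast
    ultimately show ?thesis by (auto simp: add_eq_0_iff)
  qed
  have "edge_flux T nE E v = s K * N K"
    unfolding edge_flux_def
  proof (rule the_equality)
    show "\<forall>L\<in>T. E \<in> element_edges L \<longrightarrow> (\<forall>x\<in>E. trace_from L v x \<bullet> nE E = s K * N K)"
      using tr same by simp
    fix c
    assume "\<forall>L\<in>T. E \<in> element_edges L \<longrightarrow> (\<forall>x\<in>E. trace_from L v x \<bullet> nE E = c)"
    then have "trace_from K v (barycenter E) \<bullet> nE E = c"
      using K element_edge_props(1)[OF element_simplex[OF K(1)] K(2)] by blast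
    then show "c = s K * N K"
      using tr[OF K] element_edge_props(1)[OF element_simplex[OF K(1)] K(2)] by simp
  qed
  then have "s K * edge_flux T nE E v = (s K)\<^sup>2 * N K" by (simp add: power2_eq_square)
  with s[OF K] show "N K = s K * edge_flux T nE E v" and "(s K)\<^sup>2 = 1" by simp_all
qed

text \<open>The elements are treated independently, with outward flux \<open>f E\<close> times the
  orientation sign. The signs of two neighbours are opposite, so the jump of the glued field
  vanishes; \<open>f = 0\<close> on the frontier gives the boundary condition.\<close>

lemma V_h_prescribed_fluxes:
  assumes nE: "unit_edge_normals T nE" and f: "\<And>E. E \<subseteq> frontier \<Omega> \<Longrightarrow> f E = 0"
  obtains v where "v \<in> V_h \<Omega> T" "\<And>E. E \<in> mesh_edges T \<Longrightarrow> edge_flux T nE E v = f E"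
proof -
  have "\<forall>K. \<exists>\<alpha> \<beta>. K \<in> T \<longrightarrow> (\<forall>E\<in>element_edges K. (\<alpha> + \<beta> *\<^sub>R barycenter E) \<bullet> outward_normal K E
      = (outward_normal K E \<bullet> nE E) * f E)"
    using RT0_prescribed_fluxes[OF element_simplex] by meson
  then obtain \<alpha> \<beta> where ab: "\<And>K E. K \<in> T \<Longrightarrow> E \<in> element_edges K \<Longrightarrow>
      (\<alpha> K + \<beta> K *\<^sub>R barycenter E) \<bullet> outward_normal K E = (outward_normal K E \<bullet> nE E) * f E"
    by metis
  define v where "v = piecewise (\<lambda>K x. \<alpha> K + \<beta> K *\<^sub>R x)"
  have v: "v x = \<alpha> K + \<beta> K *\<^sub>R x" if "K \<in> T" "x \<in> interior K" for K x
    unfolding v_def by (rule piecewise_eq[OF that])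
  have nt: "normal_trace K E v (barycenter E) = (outward_normal K E \<bullet> nE E) * f E"
    if "K \<in> T" "E \<in> element_edges K" for K E
    using RT0_normal_trace(2)[OF element_simplex[OF that(1)] that(2) _ v[OF that(1)]]
      element_edge_props(1)[OF element_simplex[OF that(1)] that(2)] ab[OF that] by simp
  have b: "boundary_flux_0 v" unfolding boundary_flux_0_def using nt f by simp
  have j: "flux_jump v E = 0" if "E \<in> mesh_edges T" "\<not> E \<subseteq> frontier \<Omega>" for E
  proof -
    obtain K where K: "K \<in> T" "E \<in> element_edges K" using mesh_edgeE[OF \<open>E \<in> mesh_edges T\<close>] .
    obtain K' where K': "K' \<noteq> K" "{K\<in>T. E \<in> element_edges K} = {K, K'}"
      "outward_normal K' E = - outward_normal K E"
      using interior_edge_elements[OF K \<open>\<not> E \<subseteq> frontier \<Omega>\<close>] .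
    have "K' \<in> T" "E \<in> element_edges K'" using K'(2) by blast+
    then show ?thesis using K'(1) by (simp add: flux_jump_def K'(2) nt K K'(3))
  qed
  have "edge_flux T nE E v = f E" if E: "E \<in> mesh_edges T" for E
  proof -
    obtain K where K: "K \<in> T" "E \<in> element_edges K" using mesh_edgeE[OF E] .
    note e = normal_trace_edge_flux[OF nE v b j K]
    have "outward_normal K E \<bullet> nE E \<noteq> 0" using e(2) by auto
    with e(1) nt[OF K] show ?thesis by simp
  qed
  moreover have "v \<in> V_h \<Omega> T" by (rule V_hI[of v \<alpha> \<beta>]) (fact v, fact b, fact j)
  ultimately show ?thesis using that by blast
qed

section \<open>Piecewise constant functions\<close>

lemma Q_h_interior:
  assumes "q \<in> Q_h \<Omega> T" "K \<in> T" "x \<in> interior K"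
  shows "q x = q (barycenter K)"
proof -
  obtain c where "\<forall>x\<in>interior K. q x = c" using assms(1,2) by (auto simp: Q_h_def)
  then show ?thesis using assms(3) barycenter_interior_triangle[OF element_simplex[OF assms(2)]] by simp
qed

lemma Q_hI:
  assumes "\<And>K x. K \<in> T \<Longrightarrow> x \<in> interior K \<Longrightarrow> q x = c K"
  shows "q \<in> Q_h \<Omega> T"
proof -
  have "q \<in> L2 \<Omega>" by (rule piecewise_continuous_L2[of "\<lambda>K x. c K", OF _ assms]) (intro continuous_intros)
  then show ?thesis using assms by (auto simp: Q_h_def)
qed

lemma Q_h_trace:
  assumes "q \<in> Q_h \<Omega> T" "K \<in> T" "E \<in> element_edges K"
  shows "trace_from K q (barycenter E) = q (barycenter K)"
proof -
  note e = element_edge_props[OF element_simplex[OF assms(2)] assms(3)]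
  have "barycenter E \<in> K" using e(1,2) by blast
  then show ?thesis
    using Q_h_interior[OF assms(1,2)]
    by (intro trace_from_eq[OF element_simplex[OF assms(2)], of _ "\<lambda>_. q (barycenter K)"]) auto
qed

text \<open>The sign is known only almost everywhere, but \<open>q\<close> is constant in the
  interior of \<open>K\<close>, a nonempty open set and hence not negligible.\<close>

lemma Q_h_nonneg:
  assumes "q \<in> Q_h \<Omega> T" "AE x in lebesgue_on \<Omega>. 0 \<le> q x" "K \<in> T"
  shows "0 \<le> q (barycenter K)"
proof (rule ccontr)
  assume neg: "\<not> 0 \<le> q (barycenter K)"
  have Ol: "\<Omega> \<in> sets lebesgue" using open_domain by (simp add: borel_open)
  have "AE x in lebesgue. x \<in> \<Omega> \<longrightarrow> 0 \<le> q x"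
    using assms(2) Ol by (simp add: AE_restrict_space_iff)
  then have "AE x in lebesgue. x \<notin> interior K"
  proof (rule AE_mp, intro AE_I2 impI)
    fix x assume "x \<in> \<Omega> \<longrightarrow> 0 \<le> q x"
    then show "x \<notin> interior K"
      using Q_h_interior[OF assms(1,3)] neg interior_element_subset[OF assms(3)] by auto
  qed
  then have "interior K \<in> null_sets lebesgue"
    by (subst (asm) AE_iff_null_sets[symmetric]) (simp_all add: borel_open)
  then have "negligible (interior K)" by (simp add: negligible_iff_null_sets)
  then have "interior K = {}" using open_not_negligible[OF open_interior] by blast
  then show False using barycenter_interior_triangle[OF element_simplex[OF assms(3)]] by simp
qed

end

section \<open>Conservation and dissipation\<close>

text \<open>Tangent inequality of the convex energy, with the slope taken at \<open>r\<close>, the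
  new density. Young's inequality with conjugate exponents \<open>m\<close> and
  \<open>m / (m - 1)\<close> replaces a derivative argument and covers zero densities as
  well.\<close>

lemma energy_density_tangent:
  assumes m: "m > 1" and r: "0 \<le> r" "0 \<le> s"
  shows "energy_density m r - energy_density m s \<le> m / (m - 1) * r powr (m - 1) * (r - s)"
proof -
  have q: "1 < m / (m - 1)" "1 / m + 1 / (m / (m - 1)) = 1" using m by (simp_all add: field_simps)
  have "(r powr (m - 1)) powr (m / (m - 1)) = r powr m" using m by (simp add: powr_powr)
  then have "s * r powr (m - 1) \<le> s powr m / m + r powr m / (m / (m - 1))"
    using Youngs_inequality[OF m q, of s "r powr (m - 1)"] r by simp
  then have "m * (s * r powr (m - 1)) \<le> m * (s powr m / m + r powr m / (m / (m - 1)))"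
    using m by (intro mult_left_mono) auto
  also have "\<dots> = s powr m + (m - 1) * r powr m" using m by (simp add: field_simps)
  finally have *: "m * (s * r powr (m - 1)) \<le> s powr m + (m - 1) * r powr m" .
  have "r powr m = r powr (m - 1) * r"
    using r(1) powr_add[of r "m - 1" 1] by (cases "r = 0") simp_all
  with * have "r powr m - s powr m \<le> m * r powr (m - 1) * (r - s)"
    by (simp add: algebra_simps)
  then have "(r powr m - s powr m) / (m - 1) \<le> m * r powr (m - 1) * (r - s) / (m - 1)"
    using m by (intro divide_right_mono) auto
  then show ?thesis by (simp add: energy_density_def diff_divide_distrib)
qed

context triangulated_domain
begin

lemma scheme_mass_conservation_energy_dissipation:
  assumes nE: "unit_edge_normals T nE" and m: "m > 1" and dt: "\<Delta>t > 0"
    and Q: "\<rho>\<^sub>0 \<in> Q_h \<Omega> T" "\<rho> \<in> Q_h \<Omega> T" "\<mu> \<in> Q_h \<Omega> T" and u: "u \<in> V_h \<Omega> T"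
    and pos: "AE x in lebesgue_on \<Omega>. \<rho>\<^sub>0 x \<ge> 0" "AE x in lebesgue_on \<Omega>. \<rho> x \<ge> 0"
    and eq1: "\<And>q. q \<in> Q_h \<Omega> T \<Longrightarrow> M_h T (\<lambda>x. (\<rho> x - \<rho>\<^sub>0 x) / \<Delta>t) q + A_h T \<rho>hat u q = 0"
    and eq2: "\<And>v. v \<in> V_h \<Omega> T \<Longrightarrow> Mbar_h T nE u v - Abar_h T \<mu> v = 0"
    and eq3: "\<And>r. r \<in> Q_h \<Omega> T \<Longrightarrow> M_h T (\<lambda>x. \<mu> x - m / (m - 1) * \<rho> x powr (m - 1)) r = 0"
  shows "M_h T \<rho> (\<lambda>_. 1) = M_h T \<rho>\<^sub>0 (\<lambda>_. 1)"
    and "M_h T (\<lambda>x. energy_density m (\<rho> x)) (\<lambda>_. 1) - M_h T (\<lambda>x. energy_density m (\<rho>\<^sub>0 x)) (\<lambda>_. 1)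
      \<le> - \<Delta>t * (\<Sum>E\<in>mesh_edges T. edge_weight T E * \<rho>hat E * (edge_flux T nE E u)\<^sup>2)"
proof -
  define s where "s K E = outward_normal K E \<bullet> nE E" for K E
  define F where "F E = edge_flux T nE E u" for E
  have V: "normal_trace K E v (barycenter E) = s K E * edge_flux T nE E v \<and> (s K E)\<^sup>2 = 1
      \<and> (E \<subseteq> frontier \<Omega> \<longrightarrow> edge_flux T nE E v = 0)"
    if v: "v \<in> V_h \<Omega> T" and K: "K \<in> T" "E \<in> element_edges K" for v K E
  proof -
    obtain \<alpha> \<beta> where v': "\<And>K x. K \<in> T \<Longrightarrow> x \<in> interior K \<Longrightarrow> v x = \<alpha> K + \<beta> K *\<^sub>R x"
      and b: "boundary_flux_0 v" and j: "\<And>E. E \<in> mesh_edges T \<Longrightarrow> \<not> E \<subseteq> frontier \<Omega> \<Longrightarrow> flux_jump v E = 0"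
      by (rule V_hE[OF v]) blast
    note e = normal_trace_edge_flux[OF nE v' b j K, folded s_def]
    have "s K E \<noteq> 0" using e(2) by auto
    with e b K show ?thesis by (auto simp: boundary_flux_0_def)
  qed
  have A: "A_h T \<rho>hat u q = (\<Sum>K\<in>T. \<Sum>E\<in>element_edges K.
      diameter E * (\<rho>hat E * (s K E * F E) * q (barycenter K)))" if "q \<in> Q_h \<Omega> T" for q
    unfolding A_h_def F_def using V[OF u] Q_h_trace[OF that] by (intro sum.cong refl) simp
  have one: "(\<lambda>_. 1) \<in> Q_h \<Omega> T" by (rule Q_hI[of _ "\<lambda>_. 1"]) simp
  \<comment> \<open>Within an edge everything but the sign \<open>s K E\<close> is common to the two
    neighbours, and the two signs cancel; on boundary edges the flux \<open>F E\<close> is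
    zero.\<close>
  have "A_h T \<rho>hat u (\<lambda>_. 1)
      = (\<Sum>E\<in>mesh_edges T. diameter E * \<rho>hat E * F E * (\<Sum>K | K \<in> T \<and> E \<in> element_edges K. s K E))"
    unfolding A[OF one] sum_elements_edges sum_distrib_left by (intro sum.cong refl) simp
  also have "\<dots> = 0"
  proof (rule sum.neutral, rule ballI)
    fix E assume "E \<in> mesh_edges T"
    then obtain K where K: "K \<in> T" "E \<in> element_edges K" by (rule mesh_edgeE)
    then show "diameter E * \<rho>hat E * F E * (\<Sum>K | K \<in> T \<and> E \<in> element_edges K. s K E) = 0"
    proof (cases rule: edge_elements_cases)
      case boundary
      then show ?thesis using V[OF u K] by (simp add: F_def)
    next
      case (inner K')
      then show ?thesis by (simp add: s_def)
    qed
  qed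
  finally have "M_h T (\<lambda>x. (\<rho> x - \<rho>\<^sub>0 x) / \<Delta>t) (\<lambda>_. 1) = 0" using eq1[OF one] by simp
  then have "(M_h T \<rho> (\<lambda>_. 1) - M_h T \<rho>\<^sub>0 (\<lambda>_. 1)) / \<Delta>t = 0"
    by (simp add: M_h_def sum_subtractf[symmetric] sum_divide_distrib right_diff_distrib diff_divide_distrib)
  then show "M_h T \<rho> (\<lambda>_. 1) = M_h T \<rho>\<^sub>0 (\<lambda>_. 1)" using dt by simp

  let ?D = "\<Sum>E\<in>mesh_edges T. edge_weight T E * \<rho>hat E * (edge_flux T nE E u)\<^sup>2"
  \<comment> \<open>The value 0 off the mesh edges makes \<open>f\<close> vanish on every subset of
    the frontier, which the construction of \<open>v\<close> asks for; nothing is known about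
    \<rho>hat on sets that are not edges.\<close>
  define f where "f E = (if E \<in> mesh_edges T then \<rho>hat E * F E else 0)" for E
  have f0: "f E = 0" if "E \<subseteq> frontier \<Omega>" for E
  proof (cases "E \<in> mesh_edges T")
    case True
    then obtain K where "K \<in> T" "E \<in> element_edges K" by (rule mesh_edgeE)
    then show ?thesis using V[OF u] that by (simp add: f_def F_def)
  qed (simp add: f_def)
  obtain v where v: "v \<in> V_h \<Omega> T" and vf: "\<And>E. E \<in> mesh_edges T \<Longrightarrow> edge_flux T nE E v = f E"
    using V_h_prescribed_fluxes[where f = f, OF nE f0] by metis
  have vF: "edge_flux T nE E v = \<rho>hat E * F E" if "K \<in> T" "E \<in> element_edges K" for K E
  proof -
    have "E \<in> mesh_edges T" using that by (auto simp: mesh_edges_def)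
    then show ?thesis using vf by (simp add: f_def)
  qed
  \<comment> \<open>The normal trace of \<open>v\<close> at an edge barycenter is
    \<open>s K E * (\<rho>hat E * F E)\<close>, the factor that already stands in
    \<open>A_h\<close>.\<close>
  have "Abar_h T \<mu> v = A_h T \<rho>hat u \<mu>"
    unfolding A[OF Q(3)] Abar_h_def using V[OF v] Q_h_trace[OF Q(3)] vF
    by (intro sum.cong refl) (simp add: mult_ac)
  \<comment> \<open>The lumped form is diagonal in the edge fluxes, so \<open>F E\<close> from
    \<open>u\<close> meets \<open>\<rho>hat E * F E\<close> from \<open>v\<close> on the same edge;
    collecting the local weights gives \<open>edge_weight\<close>.\<close>
  moreover have "Mbar_h T nE u v = ?D"
  proof -
    have "Mbar_h T nE u v = (\<Sum>K\<in>T. \<Sum>E\<in>element_edges K. local_weight K E * (\<rho>hat E * (F E)\<^sup>2))"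
      unfolding Mbar_h_def F_def[symmetric] by (intro sum.cong refl) (simp add: vF power2_eq_square)
    also have "\<dots> = ?D"
      unfolding sum_elements_edges F_def[symmetric] edge_weight_def
      by (simp add: sum_distrib_right mult.assoc)
    finally show ?thesis .
  qed
  ultimately have "M_h T (\<lambda>x. (\<rho> x - \<rho>\<^sub>0 x) / \<Delta>t) \<mu> = - ?D"
    using eq1[OF Q(3)] eq2[OF v] by simp
  moreover have "M_h T (\<lambda>x. (\<rho> x - \<rho>\<^sub>0 x) / \<Delta>t) \<mu> = M_h T \<mu> (\<lambda>x. \<rho> x - \<rho>\<^sub>0 x) / \<Delta>t"
    by (simp add: M_h_def sum_divide_distrib mult_ac)
  ultimately have diss: "M_h T \<mu> (\<lambda>x. \<rho> x - \<rho>\<^sub>0 x) = - \<Delta>t * ?D" using dt by (simp add: field_simps)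
  \<comment> \<open>The density increment is the test function for the third equation, where it
    exchanges the slope of the energy at \<rho> for \<mu>.\<close>
  have diff: "(\<lambda>x. \<rho> x - \<rho>\<^sub>0 x) \<in> Q_h \<Omega> T"
    by (rule Q_hI[of _ "\<lambda>K. \<rho> (barycenter K) - \<rho>\<^sub>0 (barycenter K)"])
      (use Q_h_interior[OF Q(1)] Q_h_interior[OF Q(2)] in simp)
  have "M_h T (\<lambda>x. energy_density m (\<rho> x)) (\<lambda>_. 1) - M_h T (\<lambda>x. energy_density m (\<rho>\<^sub>0 x)) (\<lambda>_. 1)
     = (\<Sum>K\<in>T. measure lebesgue K *
         (energy_density m (\<rho> (barycenter K)) - energy_density m (\<rho>\<^sub>0 (barycenter K))))"
    by (simp add: M_h_def sum_subtractf[symmetric] right_diff_distrib)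
  \<comment> \<open>The one-point rule has the areas as weights, which are nonnegative, so the
    tangent inequality applies element by element.\<close>
  also have "\<dots> \<le> (\<Sum>K\<in>T. measure lebesgue K * (m / (m - 1) * \<rho> (barycenter K) powr (m - 1)
         * (\<rho> (barycenter K) - \<rho>\<^sub>0 (barycenter K))))"
    by (intro sum_mono mult_left_mono energy_density_tangent[OF m] measure_nonneg
        Q_h_nonneg[OF Q(1) pos(1)] Q_h_nonneg[OF Q(2) pos(2)])
  also have "\<dots> = M_h T \<mu> (\<lambda>x. \<rho> x - \<rho>\<^sub>0 x)"
    using eq3[OF diff]
    by (simp add: M_h_def left_diff_distrib right_diff_distrib[of "measure _ _"] sum_subtractf)
  finally show "M_h T (\<lambda>x. energy_density m (\<rho> x)) (\<lambda>_. 1) - M_h T (\<lambda>x. energy_density m (\<rho>\<^sub>0 x)) (\<lambda>_. 1)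
      \<le> - \<Delta>t * ?D" unfolding diss .
qed

end

theorem theorem3p1:
  fixes \<Omega> :: "(real^2) set" and T :: "(real^2) set set"
    and nE :: "(real^2) set \<Rightarrow> real^2"
    and m \<Delta>t :: real
    and \<rho>\<^sub>0 \<rho> \<mu> :: "real^2 \<Rightarrow> real"  (* \<rho>\<^sub>0 is the density at step n-1 *)
    and u :: "real^2 \<Rightarrow> real^2"
    and \<rho>hat :: "(real^2) set \<Rightarrow> real"
  assumes "polygonal_domain \<Omega>" and "triangulates T \<Omega>" and "delaunay T"
    and "unit_edge_normals T nE"
    and "m > 1" and "\<Delta>t > 0"
    and "\<rho>\<^sub>0 \<in> Q_h \<Omega> T" and "\<rho> \<in> Q_h \<Omega> T" and "\<mu> \<in> Q_h \<Omega> T" and "u \<in> V_h \<Omega> T"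
    and "AE x in lebesgue_on \<Omega>. \<rho>\<^sub>0 x \<ge> 0" and "AE x in lebesgue_on \<Omega>. \<rho> x \<ge> 0"
    and "upwind_flux T u \<rho>\<^sub>0 \<rho>hat"
    and "\<And>q. q \<in> Q_h \<Omega> T \<Longrightarrow> M_h T (\<lambda>x. (\<rho> x - \<rho>\<^sub>0 x) / \<Delta>t) q + A_h T \<rho>hat u q = 0"
    and "\<And>v. v \<in> V_h \<Omega> T \<Longrightarrow> Mbar_h T nE u v - Abar_h T \<mu> v = 0"
    and "\<And>r. r \<in> Q_h \<Omega> T \<Longrightarrow> M_h T (\<lambda>x. \<mu> x - m / (m - 1) * \<rho> x powr (m - 1)) r = 0"
  shows "M_h T \<rho> (\<lambda>_. 1) = M_h T \<rho>\<^sub>0 (\<lambda>_. 1) \<and>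
         M_h T (\<lambda>x. energy_density m (\<rho> x)) (\<lambda>_. 1) - M_h T (\<lambda>x. energy_density m (\<rho>\<^sub>0 x)) (\<lambda>_. 1)
           \<le> - \<Delta>t * (\<Sum>E\<in>mesh_edges T. edge_weight T E * \<rho>hat E * (edge_flux T nE E u)\<^sup>2)"
proof -
  interpret triangulated_domain \<Omega> T by unfold_locales fact+
  show ?thesis
    using scheme_mass_conservation_energy_dissipation[OF assms(4-12,14-16)] by blast
qed

end
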